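(* Let $n\geq 2$ and let $Z$ be a projection body in $\mathbb{R}^n$. Then $$|Z|^{\frac{1}{n}}\,\min_{\xi\in S^{n-1}}S(P_{\xi^{\perp}}(Z))\leq 2b_n\,S(Z).$$
   Context: A convex body in $\mathbb{R}^n$ is a compact convex set with non-empty interior. $|\cdot|$ denotes volume (in the appropriate dimension), $\omega_m$ is the volume of the Euclidean unit ball $B_2^m$ in $\mathbb{R}^m$, $S^{n-1}$ is the Euclidean unit sphere, and $P_{\xi^{\perp}}$ is the orthogonal projection onto the hyperplane $\xi^{\perp}$. $S(A)$ is the surface area of a convex body $A$; $P_{\xi^\perp}(Z)$ is regarded as a convex body in the $(n-1)$-dimensional Euclidean space $\xi^\perp$, and its surface area is taken there. In dimension $m$ one has $S(A)=mV((A,m-1),(B_2^m,1))$ (a mixed volume); in particular the surface area of a segment in a one-dimensional space is $2$. The constant $b_n$ is $$b_n=\frac{(n-1)\omega_{n-1}}{n\omega_n^{\frac{n-1}{n}}}.$$ The projection body $\Pi K$ of a convex body $K$ in $\mathbb{R}^n$ is the symmetric convex body whose support function satisfies $h_{\Pi K}(\xi)=|P_{\xi^{\perp}}(K)|$ for all $\xi\in S^{n-1}$. A projection body is a convex body of the form $Z=\Pi K$ for some convex body $K$ in $\mathbb{R}^n$ (equivalently, an origin-symmetric zonoid with non-empty interior). *)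

theory Defs
  imports "HOL-Analysis.Analysis"
begin

definition convex_body :: "'a::euclidean_space set \<Rightarrow> bool" where
  "convex_body K \<longleftrightarrow> compact K \<and> convex K \<and> interior K \<noteq> {}"

definition support_function :: "'a::euclidean_space set \<Rightarrow> 'a \<Rightarrow> real" where
  "support_function K u = (SUP x\<in>K. u \<bullet> x)"

definition orthonormal_basis_of :: "'a::euclidean_space set \<Rightarrow> 'a set \<Rightarrow> bool" where
  "orthonormal_basis_of S B \<longleftrightarrow>
     pairwise orthogonal B \<and> (\<forall>b\<in>B. norm b = 1) \<and> span B = S"

lemma orthonormal_basis_of_exists:
  assumes "subspace S"
  shows "\<exists>B. orthonormal_basis_of S B"
  using orthonormal_basis_subspace[OF assms] unfolding orthonormal_basis_of_def by metis

text \<open>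
  Lebesgue measure of dimension \<open>dim S\<close> on a linear subspace \<open>S\<close>, obtained exactly as
  \<^const>\<open>lborel\<close> is, but with an orthonormal basis of \<open>S\<close> in place of \<^const>\<open>Basis\<close>.
  Lebesgue measure is invariant under orthogonal maps, so the chosen basis is immaterial.
\<close>
definition subspace_lborel :: "'a::euclidean_space set \<Rightarrow> 'a measure" where
  "subspace_lborel S =
     (let B = (SOME B. orthonormal_basis_of S B)
      in distr (\<Pi>\<^sub>M b\<in>B. lborel) borel (\<lambda>f. \<Sum>b\<in>B. f b *\<^sub>R b))"

text \<open>
  The right derivative at \<open>t = 0\<close> of the \<open>\<mu>\<close>-volume of \<open>A + t U\<close>. If \<open>\<mu>\<close> is \<open>m\<close>-dimensional
  Lebesgue measure, this is \<open>m V((A, m - 1), (U, 1))\<close>. The limit exists for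
  compact convex \<open>A\<close> and \<open>U\<close>, the volume being a polynomial in \<open>t \<ge> 0\<close>.
\<close>
definition first_variation :: "'a::euclidean_space measure \<Rightarrow> 'a set \<Rightarrow> 'a set \<Rightarrow> real" where
  "first_variation \<mu> A U =
     Lim (at_right 0)
       (\<lambda>t. (measure \<mu> {x + t *\<^sub>R y | x y. x \<in> A \<and> y \<in> U} - measure \<mu> A) / t)"

definition surface_area :: "'a::euclidean_space set \<Rightarrow> real" where
  "surface_area A = first_variation lborel A (cball 0 1)"

text \<open>The surface area of a body \<open>A \<subseteq> S\<close>, taken inside the Euclidean space \<open>S\<close>.\<close>
definition surface_area_in :: "'a::euclidean_space set \<Rightarrow> 'a set \<Rightarrow> real" where
  "surface_area_in S A = first_variation (subspace_lborel S) A (cball 0 1 \<inter> S)"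

definition perp :: "'a::euclidean_space \<Rightarrow> 'a set" where
  "perp \<xi> = {x. \<xi> \<bullet> x = 0}"

definition perp_proj :: "'a::euclidean_space \<Rightarrow> 'a \<Rightarrow> 'a" where
  "perp_proj \<xi> x = x - ((\<xi> \<bullet> x) / (\<xi> \<bullet> \<xi>)) *\<^sub>R \<xi>"

lemma perp_proj_in_perp: "perp_proj \<xi> x \<in> perp \<xi>"
  by (simp add: perp_proj_def perp_def inner_diff_right)

lemma perp_proj_orthogonal: "y \<in> perp \<xi> \<Longrightarrow> (x - perp_proj \<xi> x) \<bullet> y = 0"
  by (simp add: perp_proj_def perp_def)

text \<open>
  The relation \<open>Z = \<Pi> K\<close>; the support function determines \<open>Z\<close>.
\<close>
definition projection_body_of :: "'a::euclidean_space set \<Rightarrow> 'a set \<Rightarrow> bool" where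
  "projection_body_of K Z \<longleftrightarrow>
     convex_body Z \<and> uminus ` Z = Z \<and>
     (\<forall>\<xi>\<in>sphere 0 1.
        support_function Z \<xi> = measure (subspace_lborel (perp \<xi>)) (perp_proj \<xi> ` K))"

definition projection_body :: "'a::euclidean_space set \<Rightarrow> bool" where
  "projection_body Z \<longleftrightarrow> (\<exists>K. convex_body K \<and> projection_body_of K Z)"

definition b_const :: "nat \<Rightarrow> real" where
  "b_const n =
     (real n - 1) * unit_ball_vol (real n - 1)
       / (real n * unit_ball_vol (real n) powr ((real n - 1) / real n))"

end

theory Submission
  imports Defs
begin

text \<open>
  A projection body \<open>Z\<close> is, up to a factor close to \<open>1\<close>, a sum \<open>W\<close> of segments \<open>[-v, v]\<close>.
  Adding \<open>s [-v, v]\<close> to a convex body \<open>A\<close> increases its volume by exactly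
  \<open>2 s \<bar>v\<bar> |P\<^sub>v A|\<close>, where \<open>P\<^sub>v\<close> projects along \<open>v\<close>. Applied to \<open>A = W\<close> this gives
  \<open>n |W| \<le> \<Sum> 2 \<bar>v\<bar> |P\<^sub>v W|\<close>, and applied to \<open>A = W + t B\<close>, with \<open>B\<close> the unit ball, it bounds
  \<open>|(1 + s) W + t B| - |W + t B|\<close> from below by \<open>s \<Sum> 2 \<bar>v\<bar> |P\<^sub>v (W + t B)|\<close>. If \<open>m\<close> is the
  least surface area of a projection of \<open>Z\<close>, the latter sum exceeds \<open>\<Sum> 2 \<bar>v\<bar> |P\<^sub>v W|\<close> by about
  \<open>2 m t \<Sum> \<bar>v\<bar>\<close>. As \<open>s\<close> and \<open>t\<close> tend to \<open>0\<close>, homogeneity turns this into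
  \<open>2 m \<Sum> \<bar>v\<bar> \<le> (n - 1) S(Z)\<close>.

  The volume of a sum of segments is at most \<open>(2 \<Sum> \<bar>v\<bar>)\<^sup>n / n!\<close>; this is weaker than Urysohn's
  inequality, but the loss is covered by the factor \<open>2\<close> in the claim.

  The volume increment caused by a segment is monotone in \<open>A\<close>. This makes
  \<open>t \<mapsto> |A + t E| - |A|\<close> superadditive for every limit \<open>E\<close> of sums of segments, in particular
  for the ball, so the surface area exists and is the infimum of the difference quotients.
\<close>

subsection \<open>Lebesgue measure and orthogonal decompositions\<close>

text \<open>No mixed volumes enter: all that is used of the volume is its increment under one
  segment and its homogeneity. The last step is Euler's identity. If V(a,t) is the volume of a Z + t
  B, then n V = dV/da + t dV/dt. At a = 1 the first derivative is at least n |Z| + 2 m t \<Sum> |v|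
  and the second at least S(Z); subtracting n |Z|, dividing by t and letting t tend to 0 leaves n
  S(Z) \<ge> 2 m \<Sum> |v| + S(Z). Finite differences in s and t stand in for the derivatives.

  That a projection body is nearly a sum of segments is usually read off Cauchy's formula, with the
  surface area measure of K as weight. Here that measure is replaced by Lebesgue measure on a thin
  parallel body of K, and the normal by the gradient of the squared distance to K. The same argument
  covers the ball, whose shadows are all equal.\<close>

lemma borel_measurable_linear:
  fixes f :: "'a::euclidean_space \<Rightarrow> 'b::euclidean_space"
  shows "linear f \<Longrightarrow> f \<in> borel_measurable borel"
  by (intro borel_measurable_continuous_onI linear_continuous_on linear_linear[THEN iffD2])

lemma uminus_image_eq_vimage: "uminus ` U = uminus -` (U :: 'a::group_add set)"
  by (auto simp: image_iff) (metis minus_minus)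

text \<open>Uniqueness of Haar measure: the double integral of
  \<open>indicator A (x + y) * indicator U y\<close> is evaluated in both orders. The product form
  avoids dividing by measures that may be infinite.\<close>

lemma emeasure_lborel_translation_invariant_unique:
  fixes M :: "'a::euclidean_space measure"
  assumes sets: "sets M = sets borel" and "sigma_finite_measure M"
    and inv: "\<And>y. distr M borel (\<lambda>x. x + y) = M"
    and U: "U \<in> sets borel" and A: "A \<in> sets borel"
  shows "emeasure M A * emeasure lborel U = emeasure lborel A * emeasure M (uminus ` U)"
proof -
  interpret M: sigma_finite_measure M by fact
  interpret P: pair_sigma_finite M "lborel :: 'a measure" ..
  note [measurable_cong] = sets
  note [measurable] = U A
  have mU: "uminus ` U = uminus -` U"
    by (rule uminus_image_eq_vimage)
  have mU_sets [measurable]: "uminus ` U \<in> sets borel"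
    unfolding mU using measurable_sets_borel[OF borel_measurable_uminus[OF measurable_ident] U] by simp
  have "emeasure M A * emeasure lborel U = (\<integral>\<^sup>+y. emeasure M A * indicator U y \<partial>lborel)"
    by (simp add: nn_integral_cmult)
  also have "\<dots> = (\<integral>\<^sup>+y. (\<integral>\<^sup>+x. indicator A (x + y) * indicator U y \<partial>M) \<partial>lborel)"
  proof (intro nn_integral_cong)
    fix y :: 'a
    have "emeasure M A = (\<integral>\<^sup>+x. indicator A x \<partial>distr M borel (\<lambda>x. x + y))"
      by (simp add: inv)
    also have "\<dots> = (\<integral>\<^sup>+x. indicator A (x + y) \<partial>M)"
      by (subst nn_integral_distr) auto
    finally show "emeasure M A * indicator U y = (\<integral>\<^sup>+x. indicator A (x + y) * indicator U y \<partial>M)"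
      by (simp add: nn_integral_multc)
  qed
  also have "\<dots> = (\<integral>\<^sup>+x. (\<integral>\<^sup>+y. indicator A (x + y) * indicator U y \<partial>lborel) \<partial>M)"
    by (rule P.Fubini') measurable
  \<comment> \<open>Shifting \<open>y\<close> by \<open>x\<close> moves the sum from
    \<open>A\<close> to \<open>U\<close>; this substitution is what reflects
    \<open>U\<close>.\<close>
  also have "\<dots> = (\<integral>\<^sup>+x. (\<integral>\<^sup>+y. indicator A y * indicator U (y - x) \<partial>lborel) \<partial>M)"
  proof (rule nn_integral_cong)
    fix x :: 'a
    have "(\<integral>\<^sup>+y. indicator A y * indicator U (y - x) \<partial>lborel)
        = (\<integral>\<^sup>+y. indicator A y * indicator U (y - x) \<partial>distr lborel borel ((+) x))"
      by (simp add: lborel_distr_plus)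
    also have "\<dots> = (\<integral>\<^sup>+y. indicator A (x + y) * indicator U y \<partial>lborel)"
      by (subst nn_integral_distr) auto
    finally show "(\<integral>\<^sup>+y. indicator A (x + y) * indicator U y \<partial>lborel)
        = (\<integral>\<^sup>+y. indicator A y * indicator U (y - x) \<partial>lborel)" ..
  qed
  also have "\<dots> = (\<integral>\<^sup>+y. (\<integral>\<^sup>+x. indicator A y * indicator U (y - x) \<partial>M) \<partial>lborel)"
    by (rule P.Fubini'[symmetric]) measurable
  also have "\<dots> = (\<integral>\<^sup>+y. indicator A y * emeasure M (uminus ` U) \<partial>lborel)"
  proof (intro nn_integral_cong)
    fix y :: 'a
    have "(\<integral>\<^sup>+x. indicator U (y - x) \<partial>M) = (\<integral>\<^sup>+x. indicator (uminus ` U) (x + - y) \<partial>M)"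
      by (intro nn_integral_cong) (auto simp: mU indicator_def)
    also have "\<dots> = (\<integral>\<^sup>+x. indicator (uminus ` U) x \<partial>distr M borel (\<lambda>x. x + - y))"
      by (subst nn_integral_distr) auto
    also have "\<dots> = emeasure M (uminus ` U)"
      unfolding inv by simp
    finally show "(\<integral>\<^sup>+x. indicator A y * indicator U (y - x) \<partial>M) = indicator A y * emeasure M (uminus ` U)"
      by (simp add: nn_integral_cmult)
  qed
  also have "\<dots> = emeasure lborel A * emeasure M (uminus ` U)"
    by (simp add: nn_integral_multc)
  finally show ?thesis .
qed

text \<open>The image measure is again translation invariant, hence a multiple of
  \<open>lborel\<close>; the unit ball, preserved by \<open>T\<close> and by reflection, fixes the
  factor as 1.\<close>

lemma distr_lborel_orthogonal:
  fixes T :: "'a::euclidean_space \<Rightarrow> 'a"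
  assumes T: "orthogonal_transformation T"
  shows "distr lborel borel T = lborel"
proof (rule measure_eqI)
  let ?M = "distr lborel borel T"
  have lin: "linear T" using T by (rule orthogonal_transformation_linear)
  have Tm [measurable]: "T \<in> borel_measurable borel"
    by (rule borel_measurable_linear[OF lin])
  have norm: "norm (T x) = norm x" for x using T by (rule orthogonal_transformation_norm)
  have ball: "emeasure ?M (ball 0 r) = emeasure lborel (ball (0::'a) r)" for r
    by (subst emeasure_distr) (auto intro!: arg_cong[where f = "emeasure lborel"] simp: norm)
  have sf: "sigma_finite_measure ?M"
  proof
    have "(\<Union>n::nat. ball (0::'a) (real n)) = UNIV"
      using reals_Archimedean2 by (auto simp: set_eq_iff)
    then show "\<exists>A. countable A \<and> A \<subseteq> sets ?M \<and> \<Union>A = space ?M \<and> (\<forall>a\<in>A. emeasure ?M a \<noteq> \<infinity>)"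
      using emeasure_lborel_ball_finite[of "0::'a"]
      by (intro exI[of _ "range (\<lambda>n::nat. ball (0::'a) (real n))"]) (auto simp: ball top.not_eq_extremum)
  qed
  have inv: "distr ?M borel (\<lambda>x. x + y) = ?M" for y
  proof -
    obtain z where z: "y = T z"
      using orthogonal_transformation_surj[OF T] by (metis surjD)
    have "distr ?M borel (\<lambda>x. x + y) = distr lborel borel (\<lambda>x. T (z + x))"
      by (subst distr_distr) (auto simp: o_def z linear_add[OF lin] add.commute)
    also have "\<dots> = distr (distr lborel borel ((+) z)) borel T"
      by (subst distr_distr) (auto simp: o_def)
    finally show ?thesis by (simp add: lborel_distr_plus)
  qed
  fix A assume "A \<in> sets ?M"
  then have A: "A \<in> sets borel" by simp
  have um: "uminus ` ball (0::'a) 1 = ball 0 1"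
    unfolding uminus_image_eq_vimage by auto
  have eq: "emeasure ?M A * emeasure lborel (ball (0::'a) 1) = emeasure lborel A * emeasure lborel (ball (0::'a) 1)"
    using emeasure_lborel_translation_invariant_unique[OF _ sf inv _ A, of "ball 0 1"]
    by (simp add: ball um)
  have "emeasure lborel (ball (0::'a) 1) \<noteq> 0" "emeasure lborel (ball (0::'a) 1) < \<infinity>"
    using emeasure_lborel_ball_finite[of "0::'a" 1] content_ball_pos[of 1 "0::'a"]
    by (auto simp: measure_def)
  then show "emeasure ?M A = emeasure lborel A"
    using eq by (auto simp: ennreal_mult_cancel_left mult.commute[of _ "emeasure lborel (ball 0 1)"])
qed simp

lemma distr_PiM_lborel_reindex:
  assumes \<sigma>: "bij_betw \<sigma> I J" and fin: "finite I"
  shows "distr (\<Pi>\<^sub>M b\<in>J. (lborel :: real measure)) (\<Pi>\<^sub>M b\<in>I. lborel) (\<lambda>f. \<lambda>b\<in>I. f (\<sigma> b))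
    = (\<Pi>\<^sub>M b\<in>I. lborel)"
proof -
  interpret product_sigma_finite "\<lambda>_. lborel :: real measure" ..
  have J: "finite J" "J = \<sigma> ` I" "inj_on \<sigma> I" using \<sigma> fin by (auto simp: bij_betw_def)
  have m [measurable]: "(\<lambda>f. \<lambda>b\<in>I. f (\<sigma> b)) \<in> (\<Pi>\<^sub>M b\<in>J. (lborel :: real measure)) \<rightarrow>\<^sub>M (\<Pi>\<^sub>M b\<in>I. lborel)"
    using J by (intro measurable_restrict measurable_component_singleton) auto
  show ?thesis
  proof (rule PiM_eqI)
    fix A :: "'a \<Rightarrow> real set" assume A: "\<And>i. i \<in> I \<Longrightarrow> A i \<in> sets lborel"
    let ?g = "the_inv_into I \<sigma>"
    have g: "?g (\<sigma> i) = i" if "i \<in> I" for i using that J by (simp add: the_inv_into_f_f)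
    have "emeasure (distr (\<Pi>\<^sub>M b\<in>J. lborel) (\<Pi>\<^sub>M b\<in>I. lborel) (\<lambda>f. \<lambda>b\<in>I. f (\<sigma> b))) (Pi\<^sub>E I A)
      = emeasure (\<Pi>\<^sub>M b\<in>J. lborel) ((\<lambda>f. \<lambda>b\<in>I. f (\<sigma> b)) -` Pi\<^sub>E I A \<inter> space (\<Pi>\<^sub>M b\<in>J. lborel))"
      using A fin by (intro emeasure_distr sets_PiM_I_finite) auto
    also have "(\<lambda>f. \<lambda>b\<in>I. f (\<sigma> b)) -` Pi\<^sub>E I A \<inter> space (\<Pi>\<^sub>M b\<in>J. lborel) = Pi\<^sub>E J (\<lambda>j. A (?g j))"
      using J g by (auto simp: space_PiM PiE_iff)
    also have "emeasure (\<Pi>\<^sub>M b\<in>J. lborel) \<dots> = (\<Prod>j\<in>J. emeasure lborel (A (?g j)))"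
      using A J g by (intro emeasure_PiM) auto
    also have "\<dots> = (\<Prod>i\<in>I. emeasure lborel (A i))"
      unfolding J(2) using J g by (subst prod.reindex) auto
    finally show "emeasure (distr (\<Pi>\<^sub>M b\<in>J. lborel) (\<Pi>\<^sub>M b\<in>I. lborel) (\<lambda>f. \<lambda>b\<in>I. f (\<sigma> b))) (Pi\<^sub>E I A)
      = (\<Prod>i\<in>I. emeasure lborel (A i))" .
  qed (use fin in auto)
qed

lemma orthonormal_basis_ofD:
  fixes B :: "'a::euclidean_space set"
  assumes "orthonormal_basis_of S B"
  shows "independent B" "finite B" "card B = dim S" "span B = S"
    "\<And>b c. b \<in> B \<Longrightarrow> c \<in> B \<Longrightarrow> b \<bullet> c = (if b = c then 1 else 0)"
proof -
  from assms have o: "pairwise orthogonal B" "\<And>b. b \<in> B \<Longrightarrow> norm b = 1" and s: "span B = S"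
    by (auto simp: orthonormal_basis_of_def)
  show "independent B"
    using o by (intro pairwise_orthogonal_independent) fastforce+
  then show "finite B" "card B = dim S" "span B = S"
    using s independent_imp_finite dim_span_eq_card_independent[of B] by auto
  show "b \<bullet> c = (if b = c then 1 else 0)" if "b \<in> B" "c \<in> B" for b c
    using o that by (auto simp: pairwise_def orthogonal_def dot_square_norm)
qed

text \<open>The linear map that sends \<open>Basis\<close> bijectively to \<open>B\<close> is
  orthogonal, so it preserves \<open>lborel\<close>; the rest is a renaming of coordinates.\<close>

lemma distr_PiM_orthonormal_basis_UNIV:
  fixes B :: "'a::euclidean_space set"
  assumes B: "orthonormal_basis_of UNIV B"
  shows "distr (\<Pi>\<^sub>M b\<in>B. lborel) borel (\<lambda>f. \<Sum>b\<in>B. f b *\<^sub>R b) = lborel"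
proof -
  note B' = orthonormal_basis_ofD[OF B]
  have "card B = card (Basis :: 'a set)" using B'(3) by simp
  then obtain \<sigma> where \<sigma>: "bij_betw \<sigma> (Basis :: 'a set) B"
    using finite_same_card_bij[OF finite_Basis B'(2)] by metis
  define T :: "'a \<Rightarrow> 'a" where "T x = (\<Sum>b\<in>Basis. (x \<bullet> b) *\<^sub>R \<sigma> b)" for x
  have \<sigma>b: "\<sigma> b \<bullet> \<sigma> c = (if b = c then 1 else 0)" if "b \<in> Basis" "c \<in> Basis" for b c
    using B'(5)[of "\<sigma> b" "\<sigma> c"] \<sigma> that by (auto simp: bij_betw_def inj_on_def)
  have T: "orthogonal_transformation T"
    unfolding orthogonal_transformation_def
  proof (intro conjI allI)
    show "linear T" unfolding T_def
      by (auto intro!: linearI simp: inner_add_left scaleR_add_left sum.distrib scaleR_sum_right)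
    fix v w :: 'a
    have "T v \<bullet> T w = (\<Sum>b\<in>Basis. \<Sum>c\<in>Basis. (v \<bullet> b) * (w \<bullet> c) * (\<sigma> b \<bullet> \<sigma> c))"
      by (simp add: T_def inner_sum_left inner_sum_right sum_distrib_left mult_ac)
        (subst sum.swap, simp add: mult_ac)
    also have "\<dots> = (\<Sum>b\<in>Basis. (v \<bullet> b) * (w \<bullet> b))"
      by (intro sum.cong refl) (simp add: \<sigma>b if_distrib[of "\<lambda>x. _ * x"] sum.delta' sum.delta cong: if_cong)
    finally show "T v \<bullet> T w = v \<bullet> w" by (simp add: euclidean_inner[of v w])
  qed
  have Tm [measurable]: "T \<in> borel_measurable borel"
    unfolding T_def by measurable
  have "lborel = distr lborel borel T" using distr_lborel_orthogonal[OF T] by simp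
  also have "\<dots> = distr (distr (\<Pi>\<^sub>M b\<in>Basis. lborel) borel (\<lambda>f. \<Sum>b\<in>Basis. f b *\<^sub>R b)) borel T"
    by (subst lborel_eq) simp
  also have "\<dots> = distr (\<Pi>\<^sub>M b\<in>Basis. lborel) borel (\<lambda>f. \<Sum>b\<in>Basis. f b *\<^sub>R \<sigma> b)"
    by (subst distr_distr) (auto simp: o_def T_def inner_sum_left inner_Basis if_distrib[of "\<lambda>x. _ * x"] cong: if_cong)
  also have "\<dots> = distr (distr (\<Pi>\<^sub>M b\<in>B. lborel) (\<Pi>\<^sub>M b\<in>Basis. lborel) (\<lambda>f. \<lambda>b\<in>Basis. f (\<sigma> b))) borel (\<lambda>f. \<Sum>b\<in>Basis. f b *\<^sub>R \<sigma> b)"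
    by (subst distr_PiM_lborel_reindex[OF \<sigma> finite_Basis]) simp
  also have "\<dots> = distr (\<Pi>\<^sub>M b\<in>B. lborel) borel (\<lambda>f. \<Sum>b\<in>Basis. f (\<sigma> b) *\<^sub>R \<sigma> b)"
  proof (subst distr_distr)
    show "(\<lambda>f. \<lambda>b\<in>Basis. f (\<sigma> b)) \<in> (\<Pi>\<^sub>M b\<in>B. (lborel :: real measure)) \<rightarrow>\<^sub>M (\<Pi>\<^sub>M b\<in>Basis. lborel)"
      using \<sigma> by (intro measurable_restrict measurable_component_singleton) (auto simp: bij_betw_def)
  qed (auto simp: o_def cong: sum.cong)
  also have "(\<lambda>f::'a \<Rightarrow> real. \<Sum>b\<in>Basis. f (\<sigma> b) *\<^sub>R \<sigma> b) = (\<lambda>f. \<Sum>b\<in>B. f b *\<^sub>R b)"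
    using sum.reindex_bij_betw[OF \<sigma>] by (auto simp: fun_eq_iff)
  finally show ?thesis ..
qed

text \<open>Fubini along the direction \<open>\<xi>\<close>: adjoining \<open>\<xi>\<close> to the
  basis chosen inside \<open>subspace_lborel\<close> gives an orthonormal basis of the whole space,
  and the product measure splits off that coordinate.\<close>

lemma nn_integral_lborel_perp:
  fixes \<xi> :: "'a::euclidean_space" and g :: "'a \<Rightarrow> ennreal"
  assumes \<xi>: "norm \<xi> = 1" and g [measurable]: "g \<in> borel_measurable borel"
  shows "(\<integral>\<^sup>+x. g x \<partial>lborel) = (\<integral>\<^sup>+y. (\<integral>\<^sup>+\<tau>. g (y + \<tau> *\<^sub>R \<xi>) \<partial>lborel) \<partial>subspace_lborel (perp \<xi>))"
proof -
  interpret product_sigma_finite "\<lambda>_. lborel :: real measure" ..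
  define B where "B = (SOME B. orthonormal_basis_of (perp \<xi>) B)"
  have "subspace (perp \<xi>)" unfolding perp_def by (rule subspace_hyperplane)
  then have B: "orthonormal_basis_of (perp \<xi>) B"
    unfolding B_def by (intro someI_ex[of "orthonormal_basis_of (perp \<xi>)"] orthonormal_basis_of_exists)
  note B' = orthonormal_basis_ofD[OF B]
  have \<xi>\<xi>: "\<xi> \<bullet> \<xi> = 1" using \<xi> by (simp add: dot_square_norm)
  have perpB: "\<xi> \<bullet> b = 0" if "b \<in> B" for b
    using B'(4) span_base[OF that] by (auto simp: perp_def)
  then have nB: "\<xi> \<notin> B" using \<xi>\<xi> by force
  have U: "orthonormal_basis_of UNIV (insert \<xi> B)"
    unfolding orthonormal_basis_of_def
  proof (intro conjI ballI)
    show "pairwise orthogonal (insert \<xi> B)"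
      using B perpB by (auto simp: orthonormal_basis_of_def pairwise_insert orthogonal_def inner_commute)
    show "norm b = 1" if "b \<in> insert \<xi> B" for b
      using B \<xi> that by (auto simp: orthonormal_basis_of_def)
    have "x \<in> span (insert \<xi> B)" for x
    proof -
      have "x - (\<xi> \<bullet> x) *\<^sub>R \<xi> \<in> perp \<xi>"
        by (simp add: perp_def inner_diff_right \<xi>\<xi>)
      then show ?thesis using B'(4) by (auto simp: span_insert)
    qed
    then show "span (insert \<xi> B) = UNIV" by auto
  qed
  have m1 [measurable]: "(\<lambda>f. \<Sum>b\<in>B. f b *\<^sub>R b) \<in> (\<Pi>\<^sub>M b\<in>B. (lborel :: real measure)) \<rightarrow>\<^sub>M borel"
    by measurable
  have m2 [measurable]: "(\<lambda>f. \<Sum>b\<in>insert \<xi> B. f b *\<^sub>R b) \<in> (\<Pi>\<^sub>M b\<in>insert \<xi> B. (lborel :: real measure)) \<rightarrow>\<^sub>M borel"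
    by measurable
  have "(\<integral>\<^sup>+x. g x \<partial>lborel) = (\<integral>\<^sup>+x. g x \<partial>distr (\<Pi>\<^sub>M b\<in>insert \<xi> B. lborel) borel (\<lambda>f. \<Sum>b\<in>insert \<xi> B. f b *\<^sub>R b))"
    by (subst distr_PiM_orthonormal_basis_UNIV[OF U]) simp
  also have "\<dots> = (\<integral>\<^sup>+f. g (\<Sum>b\<in>insert \<xi> B. f b *\<^sub>R b) \<partial>(\<Pi>\<^sub>M b\<in>insert \<xi> B. lborel))"
    by (subst nn_integral_distr) auto
  also have "\<dots> = (\<integral>\<^sup>+f. (\<integral>\<^sup>+\<tau>. g (\<Sum>b\<in>insert \<xi> B. (f(\<xi> := \<tau>)) b *\<^sub>R b) \<partial>lborel) \<partial>(\<Pi>\<^sub>M b\<in>B. lborel))"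
    using B'(2) nB by (intro product_nn_integral_insert) auto
  also have "\<dots> = (\<integral>\<^sup>+f. (\<integral>\<^sup>+\<tau>. g ((\<Sum>b\<in>B. f b *\<^sub>R b) + \<tau> *\<^sub>R \<xi>) \<partial>lborel) \<partial>(\<Pi>\<^sub>M b\<in>B. lborel))"
  proof -
    have "(\<Sum>b\<in>insert \<xi> B. (f(\<xi> := \<tau>)) b *\<^sub>R b) = (\<Sum>b\<in>B. f b *\<^sub>R b) + \<tau> *\<^sub>R \<xi>" for f :: "'a \<Rightarrow> real" and \<tau>
    proof -
      have "(\<Sum>b\<in>B. (f(\<xi> := \<tau>)) b *\<^sub>R b) = (\<Sum>b\<in>B. f b *\<^sub>R b)"
        using nB by (intro sum.cong) auto
      then show ?thesis using B'(2) nB by (simp add: add.commute)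
    qed
    then show ?thesis by simp
  qed
  also have "\<dots> = (\<integral>\<^sup>+y. (\<integral>\<^sup>+\<tau>. g (y + \<tau> *\<^sub>R \<xi>) \<partial>lborel) \<partial>distr (\<Pi>\<^sub>M b\<in>B. lborel) borel (\<lambda>f. \<Sum>b\<in>B. f b *\<^sub>R b))"
    by (subst nn_integral_distr) auto
  also have "distr (\<Pi>\<^sub>M b\<in>B. lborel) borel (\<lambda>f. \<Sum>b\<in>B. f b *\<^sub>R b) = subspace_lborel (perp \<xi>)"
    by (simp add: subspace_lborel_def B_def Let_def)
  finally show ?thesis .
qed

lemma sets_subspace_lborel [simp, measurable_cong]: "sets (subspace_lborel S) = sets borel"
  by (simp add: subspace_lborel_def Let_def)

text \<open>\<open>subspace_lborel S\<close> is a measure on the ambient space. That it is carried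
  by \<open>S\<close> allows statements about lines to be restricted to base points in the
  hyperplane.\<close>

lemma AE_subspace_lborel:
  fixes S :: "'a::euclidean_space set"
  assumes "subspace S"
  shows "AE y in subspace_lborel S. y \<in> S"
proof -
  define B where "B = (SOME B. orthonormal_basis_of S B)"
  have B: "orthonormal_basis_of S B"
    unfolding B_def using orthonormal_basis_of_exists[OF assms] by (rule someI_ex)
  have S: "S \<in> sets borel" using closed_subspace[OF assms] by auto
  have "(\<Sum>b\<in>B. f b *\<^sub>R b) \<in> S" for f :: "'a \<Rightarrow> real"
    unfolding orthonormal_basis_ofD(4)[OF B, symmetric] by (intro span_sum span_scale span_base)
  then show ?thesis
    unfolding subspace_lborel_def B_def[symmetric] Let_def
    by (subst AE_distr_iff) (use S in auto)
qed

subsection \<open>Adding a segment to a convex body\<close>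

abbreviation vol :: "'a::euclidean_space set \<Rightarrow> real" where
  "vol \<equiv> measure lborel"

definition seg :: "'a::real_vector \<Rightarrow> 'a set" where
  "seg v = (\<lambda>t. t *\<^sub>R v) ` {-1..1}"

text \<open>A list, so that repeated vectors count with multiplicity and inductions add one segment
  at a time.\<close>

definition zonotope :: "'a::real_vector list \<Rightarrow> 'a set" where
  "zonotope vs = sum_list (map seg vs)"

definition shadow :: "'a::euclidean_space \<Rightarrow> 'a set \<Rightarrow> real" where
  "shadow \<xi> A = measure (subspace_lborel (perp \<xi>)) (perp_proj \<xi> ` A)"

text \<open>Weaker than \<open>convex_body\<close>, so that segments, points and projections into
  hyperplanes are included.\<close>

definition compact_convex :: "'a::euclidean_space set \<Rightarrow> bool" where
  "compact_convex A \<longleftrightarrow> compact A \<and> convex A"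

lemma compact_convexD: "compact_convex A \<Longrightarrow> compact A" "compact_convex A \<Longrightarrow> convex A"
  by (auto simp: compact_convex_def)

lemma set_plus_eq: "A + B = {x + y | x y. x \<in> A \<and> y \<in> B}"
  by (auto simp: set_plus_def)

lemma compact_convex_plus: "compact_convex A \<Longrightarrow> compact_convex B \<Longrightarrow> compact_convex (A + B)"
  unfolding compact_convex_def using compact_sums[of A B] convex_set_plus[of A B]
  by (simp add: set_plus_eq)

lemma compact_convex_linear_image:
  "linear f \<Longrightarrow> compact_convex A \<Longrightarrow> compact_convex (f ` A)"
  unfolding compact_convex_def
  by (auto intro: compact_continuous_image linear_continuous_on convex_linear_image simp: linear_conv_bounded_linear)

lemma compact_convex_scale: "compact_convex A \<Longrightarrow> compact_convex ((*\<^sub>R) c ` A)"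
  by (intro compact_convex_linear_image) (simp_all add: linear_scaleR)

lemma compact_convex_singleton [simp]: "compact_convex {a}"
  by (simp add: compact_convex_def)

lemma compact_convex_cball [simp]: "compact_convex (cball a r)"
  by (simp add: compact_convex_def)

lemma compact_convex_seg [simp]: "compact_convex (seg v)"
  unfolding seg_def compact_convex_def
  by (auto intro!: compact_continuous_image continuous_intros convex_linear_image linearI simp: scaleR_add_left)

lemma zonotope_Nil [simp]: "zonotope [] = {0}"
  by (simp add: zonotope_def)

lemma zonotope_Cons [simp]: "zonotope (v # vs) = seg v + zonotope vs"
  by (simp add: zonotope_def)

lemma compact_convex_zonotope [simp]: "compact_convex (zonotope vs)"
  by (induction vs) (auto intro: compact_convex_plus)

lemma zero_in_seg [simp]: "0 \<in> seg v"
  unfolding seg_def by (rule image_eqI[of _ _ 0]) auto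

lemma zero_in_zonotope [simp]: "0 \<in> zonotope vs"
proof (induction vs)
  case (Cons v vs)
  then have "0 + 0 \<in> seg v + zonotope vs" by (intro set_plus_intro) auto
  then show ?case by simp
qed simp

lemma seg_0 [simp]: "seg 0 = {0}"
  by (auto simp: seg_def intro!: image_eqI[of _ _ 0])

lemma linear_image_plus: "linear f \<Longrightarrow> f ` (A + B) = f ` A + f ` B"
  by (auto simp: set_plus_def linear_add image_iff) (metis linear_add)+

lemma linear_image_seg: "linear f \<Longrightarrow> f ` seg v = seg (f v)"
  by (auto simp: seg_def image_image linear_scale)

lemma linear_image_zonotope: "linear f \<Longrightarrow> f ` zonotope vs = zonotope (map f vs)"
  by (induction vs) (auto simp: linear_image_plus linear_image_seg linear_0)

lemma compact_convex_borel [measurable]: "compact_convex A \<Longrightarrow> A \<in> sets borel"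
  by (simp add: compact_convex_def borel_compact)

section \<open>Projections along a direction and sections by parallel lines\<close>

lemma linear_perp_proj: "linear (perp_proj \<xi>)"
  unfolding perp_proj_def
  by (auto intro!: linearI simp: inner_add_right add_divide_distrib algebra_simps)

lemma perp_proj_id: "y \<in> perp \<xi> \<Longrightarrow> perp_proj \<xi> y = y"
  by (simp add: perp_proj_def perp_def)

lemma perp_proj_line: "norm \<xi> = 1 \<Longrightarrow> perp_proj \<xi> (x + t *\<^sub>R \<xi>) = perp_proj \<xi> x"
  by (simp add: perp_proj_def inner_add_right dot_square_norm algebra_simps)

lemma perp_proj_decomp: "norm \<xi> = 1 \<Longrightarrow> x = perp_proj \<xi> x + (\<xi> \<bullet> x) *\<^sub>R \<xi>"
  by (simp add: perp_proj_def dot_square_norm)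

lemma mem_perp_proj_image_iff:
  assumes "norm \<xi> = 1" "y \<in> perp \<xi>"
  shows "y \<in> perp_proj \<xi> ` A \<longleftrightarrow> (\<exists>\<tau>. y + \<tau> *\<^sub>R \<xi> \<in> A)"
proof
  assume "y \<in> perp_proj \<xi> ` A"
  then obtain a where "a \<in> A" "y = perp_proj \<xi> a" by auto
  then show "\<exists>\<tau>. y + \<tau> *\<^sub>R \<xi> \<in> A" using perp_proj_decomp[OF assms(1), of a] by metis
next
  assume "\<exists>\<tau>. y + \<tau> *\<^sub>R \<xi> \<in> A"
  then obtain \<tau> where "y + \<tau> *\<^sub>R \<xi> \<in> A" by auto
  then show "y \<in> perp_proj \<xi> ` A"
    using assms by (auto intro!: image_eqI[of y] simp: perp_proj_line perp_proj_id)
qed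

text \<open>The case \<open>b < a\<close> stands for a line that misses \<open>A\<close>.\<close>

lemma compact_convex_line_section:
  fixes A :: "'a::euclidean_space set"
  assumes A: "compact_convex A" and \<xi>: "norm \<xi> = 1"
  obtains a b where "{\<tau>. y + \<tau> *\<^sub>R \<xi> \<in> A} = {a..b}"
proof -
  let ?f = "\<lambda>\<tau>. y + \<tau> *\<^sub>R \<xi>" let ?S = "{\<tau>. ?f \<tau> \<in> A}"
  have "convex ?S"
  proof (rule convexI)
    fix s t u v :: real assume h: "s \<in> ?S" "t \<in> ?S" "0 \<le> u" "0 \<le> v" "u + v = 1"
    have "?f (u *\<^sub>R s + v *\<^sub>R t) = u *\<^sub>R ?f s + v *\<^sub>R ?f t + (1 - (u + v)) *\<^sub>R y"
      by (simp add: algebra_simps)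
    also have "\<dots> = u *\<^sub>R ?f s + v *\<^sub>R ?f t" using h(5) by simp
    also have "\<dots> \<in> A"
      using h A by (intro convexD[of A]) (auto simp: compact_convex_def)
    finally show "u *\<^sub>R s + v *\<^sub>R t \<in> ?S" by simp
  qed
  moreover have "compact ?S"
  proof -
    have "closed ?S"
      using continuous_closed_vimage[of A ?f] compact_imp_closed[OF compact_convexD(1)[OF A]]
      by (simp add: vimage_def)
    moreover obtain R where R: "\<And>x. x \<in> A \<Longrightarrow> norm x \<le> R"
      using compact_imp_bounded[OF compact_convexD(1)[OF A]] by (auto simp: bounded_iff)
    have "\<bar>\<tau>\<bar> \<le> R + norm y" if "\<tau> \<in> ?S" for \<tau>
    proof -
      have "\<bar>\<tau>\<bar> = norm (?f \<tau> - y)" using \<xi> by simp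
      also have "\<dots> \<le> norm (?f \<tau>) + norm y" by (rule norm_triangle_ineq4)
      finally show ?thesis using R[of "?f \<tau>"] that by simp
    qed
    then have "bounded ?S" unfolding bounded_iff by auto
    ultimately show ?thesis by (simp add: compact_eq_bounded_closed)
  qed
  ultimately show ?thesis
    using that connected_compact_interval_1[of ?S] convex_connected by auto
qed

lemma mem_plus_seg:
  "x \<in> A + seg (s *\<^sub>R \<xi>) \<longleftrightarrow> (\<exists>r\<in>{-1..1}. x - (r * s) *\<^sub>R \<xi> \<in> A)"
proof
  assume "x \<in> A + seg (s *\<^sub>R \<xi>)"
  then obtain a r where "a \<in> A" "r \<in> {-1..1}" "x = a + (r * s) *\<^sub>R \<xi>"
    by (auto simp: set_plus_def seg_def)
  then show "\<exists>r\<in>{-1..1}. x - (r * s) *\<^sub>R \<xi> \<in> A"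
    by (intro bexI[of _ r]) auto
next
  assume "\<exists>r\<in>{-1..1}. x - (r * s) *\<^sub>R \<xi> \<in> A"
  then obtain r where r: "r \<in> {-1..1}" "x - (r * s) *\<^sub>R \<xi> \<in> A" by auto
  have "(x - (r * s) *\<^sub>R \<xi>) + r *\<^sub>R (s *\<^sub>R \<xi>) \<in> A + seg (s *\<^sub>R \<xi>)"
    using r by (intro set_plus_intro) (auto simp: seg_def)
  then show "x \<in> A + seg (s *\<^sub>R \<xi>)" by simp
qed

text \<open>A line that meets \<open>A\<close> cuts out an interval, which the segment lengthens by
  \<open>s\<close> at both ends; a line that misses \<open>A\<close> still misses the sum.\<close>

lemma emeasure_line_section_plus_seg:
  fixes A :: "'a::euclidean_space set"
  assumes A: "compact_convex A" and \<xi>: "norm \<xi> = 1" and s: "0 \<le> s" and y: "y \<in> perp \<xi>"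
  shows "emeasure lborel {\<tau>. y + \<tau> *\<^sub>R \<xi> \<in> A + seg (s *\<^sub>R \<xi>)}
    = emeasure lborel {\<tau>. y + \<tau> *\<^sub>R \<xi> \<in> A} + ennreal (2 * s) * indicator (perp_proj \<xi> ` A) y"
proof -
  obtain a b where ab: "{\<tau>. y + \<tau> *\<^sub>R \<xi> \<in> A} = {a..b}"
    using compact_convex_line_section[OF A \<xi>] by metis
  then have ab': "y + \<tau> *\<^sub>R \<xi> \<in> A \<longleftrightarrow> a \<le> \<tau> \<and> \<tau> \<le> b" for \<tau> by (auto simp: set_eq_iff)
  have sec: "y + \<tau> *\<^sub>R \<xi> \<in> A + seg (s *\<^sub>R \<xi>) \<longleftrightarrow> (\<exists>r\<in>{-1..1}. a \<le> \<tau> - r * s \<and> \<tau> - r * s \<le> b)" for \<tau>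
  proof -
    have "y + \<tau> *\<^sub>R \<xi> - (r * s) *\<^sub>R \<xi> = y + (\<tau> - r * s) *\<^sub>R \<xi>" for r
      by (simp add: algebra_simps)
    then show ?thesis unfolding mem_plus_seg by (simp only: ab')
  qed
  show ?thesis
  proof (cases "a \<le> b")
    case True
    have "y + \<tau> *\<^sub>R \<xi> \<in> A + seg (s *\<^sub>R \<xi>) \<longleftrightarrow> \<tau> \<in> {a - s..b + s}" for \<tau>
      unfolding sec
    proof
      assume "\<exists>r\<in>{-1..1}. a \<le> \<tau> - r * s \<and> \<tau> - r * s \<le> b"
      then obtain r where r: "r \<in> {-1..1}" "a \<le> \<tau> - r * s" "\<tau> - r * s \<le> b" by auto
      have "\<bar>r * s\<bar> \<le> 1 * s" unfolding abs_mult using r s by (intro mult_mono) auto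
      with r show "\<tau> \<in> {a - s..b + s}" by auto
    next
      assume \<tau>: "\<tau> \<in> {a - s..b + s}"
      show "\<exists>r\<in>{-1..1}. a \<le> \<tau> - r * s \<and> \<tau> - r * s \<le> b"
      proof (cases "s = 0")
        case True
        with \<tau> show ?thesis by (intro bexI[of _ 0]) auto
      next
        case False
        \<comment> \<open>The signed overshoot of \<open>\<tau>\<close> beyond the interval;
          subtracting it moves \<open>\<tau>\<close> to the nearest point between \<open>a\<close>
          and \<open>b\<close>.\<close>
        define d where "d = (if \<tau> < a then \<tau> - a else if b < \<tau> then \<tau> - b else 0)"
        have "\<bar>d\<bar> \<le> s" "a \<le> \<tau> - d" "\<tau> - d \<le> b" using \<tau> True s by (auto simp: d_def)
        then show ?thesis using False s
          by (intro bexI[of _ "d / s"]) (auto simp: field_simps abs_le_iff)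
      qed
    qed
    then have "{\<tau>. y + \<tau> *\<^sub>R \<xi> \<in> A + seg (s *\<^sub>R \<xi>)} = {a - s..b + s}"
      by (simp add: set_eq_iff)
    moreover have "y \<in> perp_proj \<xi> ` A"
      unfolding mem_perp_proj_image_iff[OF \<xi> y] ab' using True by auto
    ultimately show ?thesis
      unfolding ab using True s ennreal_plus[of "b - a" "2 * s"] by (simp add: algebra_simps)
  next
    case False
    then have ne: "\<not> (a \<le> \<tau> \<and> \<tau> \<le> b)" for \<tau> by linarith
    then have "{\<tau>. y + \<tau> *\<^sub>R \<xi> \<in> A + seg (s *\<^sub>R \<xi>)} = {}" by (simp add: sec)
    moreover have "y \<notin> perp_proj \<xi> ` A"
      unfolding mem_perp_proj_image_iff[OF \<xi> y] ab' using ne by simp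
    ultimately show ?thesis unfolding ab using False by simp
  qed
qed

lemma emeasure_lborel_perp:
  fixes A :: "'a::euclidean_space set"
  assumes "norm \<xi> = 1" and [measurable]: "A \<in> sets borel"
  shows "emeasure lborel A = (\<integral>\<^sup>+y. emeasure lborel {\<tau>. y + \<tau> *\<^sub>R \<xi> \<in> A} \<partial>subspace_lborel (perp \<xi>))"
proof -
  have "(\<integral>\<^sup>+\<tau>. indicator A (y + \<tau> *\<^sub>R \<xi>) \<partial>lborel) = emeasure lborel {\<tau>. y + \<tau> *\<^sub>R \<xi> \<in> A}" for y
  proof -
    have "(\<lambda>\<tau>. indicator A (y + \<tau> *\<^sub>R \<xi>)) = (indicator {\<tau>. y + \<tau> *\<^sub>R \<xi> \<in> A} :: real \<Rightarrow> ennreal)"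
      by (auto simp: indicator_def)
    then show ?thesis by simp
  qed
  then show ?thesis
    using nn_integral_lborel_perp[OF assms(1), of "indicator A"] by simp
qed

lemma subspace_perp: "subspace (perp \<xi>)"
  unfolding perp_def by (rule subspace_hyperplane)

text \<open>The line formula is integrated over the hyperplane. It is stated in
  \<open>ennreal\<close> because the finiteness of the shadow is derived from it afterwards.\<close>

lemma emeasure_plus_seg:
  fixes A :: "'a::euclidean_space set"
  assumes A: "compact_convex A" and \<xi>: "norm \<xi> = 1" and s: "0 \<le> s"
  shows "emeasure lborel (A + seg (s *\<^sub>R \<xi>))
    = emeasure lborel A + ennreal (2 * s) * emeasure (subspace_lborel (perp \<xi>)) (perp_proj \<xi> ` A)"
proof -
  let ?L = "subspace_lborel (perp \<xi>)" let ?S = "\<lambda>A y. emeasure lborel {\<tau>. y + \<tau> *\<^sub>R \<xi> \<in> A}"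
  have As: "compact_convex (A + seg (s *\<^sub>R \<xi>))" using A by (simp add: compact_convex_plus)
  have PA: "compact_convex (perp_proj \<xi> ` A)"
    using A by (intro compact_convex_linear_image linear_perp_proj)
  note [measurable] = compact_convex_borel[OF A] compact_convex_borel[OF As] compact_convex_borel[OF PA]
  have Sm [measurable]: "?S A \<in> borel_measurable borel"
  proof -
    have "(\<lambda>\<tau>. indicator A (y + \<tau> *\<^sub>R \<xi>)) = (indicator {\<tau>. y + \<tau> *\<^sub>R \<xi> \<in> A} :: real \<Rightarrow> ennreal)" for y
      by (auto simp: indicator_def)
    then have "?S A = (\<lambda>y. \<integral>\<^sup>+\<tau>. indicator A (y + \<tau> *\<^sub>R \<xi>) \<partial>lborel)" by simp
    then show ?thesis by simp
  qed
  have "emeasure lborel (A + seg (s *\<^sub>R \<xi>)) = (\<integral>\<^sup>+y. ?S (A + seg (s *\<^sub>R \<xi>)) y \<partial>?L)"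
    by (rule emeasure_lborel_perp[OF \<xi>]) measurable
  also have "\<dots> = (\<integral>\<^sup>+y. ?S A y + ennreal (2 * s) * indicator (perp_proj \<xi> ` A) y \<partial>?L)"
    using AE_subspace_lborel[OF subspace_perp[of \<xi>]]
    by (intro nn_integral_cong_AE) (auto elim!: eventually_mono simp: emeasure_line_section_plus_seg[OF A \<xi> s])
  also have "\<dots> = (\<integral>\<^sup>+y. ?S A y \<partial>?L) + ennreal (2 * s) * emeasure ?L (perp_proj \<xi> ` A)"
    by (subst nn_integral_add) (auto simp: nn_integral_cmult_indicator)
  also have "(\<integral>\<^sup>+y. ?S A y \<partial>?L) = emeasure lborel A"
    by (rule emeasure_lborel_perp[OF \<xi>, symmetric]) measurable
  finally show ?thesis .
qed

lemma emeasure_compact_convex_finite: "compact_convex A \<Longrightarrow> emeasure lborel A < \<infinity>"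
  by (intro emeasure_bounded_finite compact_imp_bounded compact_convexD)

text \<open>The sum of \<open>A\<close> and a segment along \<open>\<xi>\<close> is bounded, and its
  volume is at least twice the shadow; so the shadow is finite.\<close>

lemma emeasure_shadow:
  assumes "compact_convex A" "norm \<xi> = 1"
  shows "emeasure (subspace_lborel (perp \<xi>)) (perp_proj \<xi> ` A) = ennreal (shadow \<xi> A)"
proof -
  have "compact_convex (A + seg (1 *\<^sub>R \<xi>))" using assms by (simp add: compact_convex_plus)
  from emeasure_compact_convex_finite[OF this]
  have "emeasure (subspace_lborel (perp \<xi>)) (perp_proj \<xi> ` A) < \<infinity>"
    using emeasure_plus_seg[OF assms, of 1] by (auto simp: ennreal_mult_less_top)
  then show ?thesis unfolding shadow_def by (simp add: emeasure_eq_ennreal_measure top.not_eq_extremum)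
qed

lemma shadow_nonneg: "0 \<le> shadow \<xi> A"
  by (simp add: shadow_def)

lemma vol_plus_seg:
  assumes A: "compact_convex A" and \<xi>: "norm \<xi> = 1" and s: "0 \<le> s"
  shows "vol (A + seg (s *\<^sub>R \<xi>)) = vol A + 2 * s * shadow \<xi> A"
proof -
  have "compact_convex (A + seg (s *\<^sub>R \<xi>))" using assms by (simp add: compact_convex_plus)
  from emeasure_compact_convex_finite[OF this] emeasure_compact_convex_finite[OF A]
  have "ennreal (vol (A + seg (s *\<^sub>R \<xi>))) = ennreal (vol A) + ennreal (2 * s) * ennreal (shadow \<xi> A)"
    using emeasure_plus_seg[OF A \<xi> s] emeasure_shadow[OF A \<xi>]
    by (metis emeasure_eq_ennreal_measure infinity_ennreal_def less_irrefl)
  also have "\<dots> = ennreal (vol A + 2 * s * shadow \<xi> A)"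
    using s by (simp add: ennreal_plus ennreal_mult' shadow_nonneg)
  finally show ?thesis
    using s by (subst (asm) ennreal_inj) (auto simp: shadow_nonneg)
qed

lemma shadow_mono:
  assumes "compact_convex A" "compact_convex B" "A \<subseteq> B" "norm \<xi> = 1"
  shows "shadow \<xi> A \<le> shadow \<xi> B"
proof -
  have "perp_proj \<xi> ` B \<in> sets (subspace_lborel (perp \<xi>))"
    using compact_convex_linear_image[OF linear_perp_proj assms(2)] by (simp add: compact_convex_borel)
  then have "ennreal (shadow \<xi> A) \<le> ennreal (shadow \<xi> B)"
    using assms by (auto simp: emeasure_shadow[symmetric] intro!: emeasure_mono image_mono)
  then show ?thesis by (simp add: shadow_nonneg)
qed

lemma vol_mono: "compact_convex A \<Longrightarrow> compact_convex B \<Longrightarrow> A \<subseteq> B \<Longrightarrow> vol A \<le> vol B"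
  by (intro measure_mono_fmeasurable)
    (use emeasure_compact_convex_finite in \<open>auto simp: fmeasurable_def compact_convex_borel\<close>)

text \<open>A shadow is the volume of the cylinder of height 1 over it, the projection itself being
  a null set. Facts about volumes thus carry over to the hyperplane.\<close>

lemma shadow_eq_vol:
  assumes A: "compact_convex A" and \<xi>: "norm \<xi> = 1"
  shows "shadow \<xi> A = vol (perp_proj \<xi> ` A + seg ((1/2) *\<^sub>R \<xi>))"
proof -
  have PA: "compact_convex (perp_proj \<xi> ` A)"
    using A by (intro compact_convex_linear_image linear_perp_proj)
  have "shadow \<xi> (perp_proj \<xi> ` A) = shadow \<xi> A"
    unfolding shadow_def by (simp add: image_image perp_proj_id perp_proj_in_perp)
  moreover have "vol (perp_proj \<xi> ` A) = 0"
  proof -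
    have "perp_proj \<xi> ` A \<subseteq> {x. \<xi> \<bullet> x = 0}" using perp_proj_in_perp[of \<xi>] by (auto simp: perp_def)
    moreover have "\<xi> \<noteq> 0" using \<xi> by auto
    ultimately have "negligible (perp_proj \<xi> ` A)"
      using negligible_hyperplane negligible_subset by blast
    then have "measure lebesgue (perp_proj \<xi> ` A) = 0" by (rule negligible_imp_measure0)
    then show ?thesis using compact_convex_borel[OF PA] by (simp add: measure_completion)
  qed
  ultimately show ?thesis using vol_plus_seg[OF PA \<xi>, of "1/2"] by simp
qed

subsection \<open>Supermodularity of the volume and existence of the surface area\<close>

text \<open>Written with \<open>sgn v\<close> so that \<open>v = 0\<close> is covered: there the
  factor \<open>norm v\<close> removes a meaningless shadow.\<close>

lemma vol_plus_seg_sgn: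
  assumes "compact_convex A"
  shows "vol (A + seg v) = vol A + 2 * norm v * shadow (sgn v) A"
proof (cases "v = 0")
  case False
  then have "vol (A + seg (norm v *\<^sub>R sgn v)) = vol A + 2 * norm v * shadow (sgn v) A"
    using assms by (intro vol_plus_seg) (auto simp: norm_sgn)
  moreover have "norm v *\<^sub>R sgn v = v" using False by (simp add: sgn_div_norm)
  ultimately show ?thesis by simp
qed simp

lemma vol_seg_mono:
  assumes "compact_convex A" "compact_convex B" "A \<subseteq> B"
  shows "vol (A + seg v) - vol A \<le> vol (B + seg v) - vol B"
proof (cases "v = 0")
  case False
  then show ?thesis
    using assms by (auto simp: vol_plus_seg_sgn norm_sgn intro!: mult_left_mono shadow_mono)
qed simp

lemma zero_in_set_plus: "0 \<in> A \<Longrightarrow> 0 \<in> B \<Longrightarrow> 0 \<in> A + (B :: 'a::monoid_add set)"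
  using set_plus_intro[of 0 A 0 B] by simp

lemma zero_in_linear_image: "linear f \<Longrightarrow> 0 \<in> A \<Longrightarrow> 0 \<in> f ` A"
  by (rule image_eqI[of _ _ 0]) (simp_all add: linear_0)

lemma zero_in_scale: "0 \<in> A \<Longrightarrow> 0 \<in> (*\<^sub>R) c ` (A :: 'a::real_vector set)"
  by (intro zero_in_linear_image linear_scaleR)

lemma set_plus_mono_zero: "0 \<in> C \<Longrightarrow> A \<subseteq> A + (C :: 'a::comm_monoid_add set)"
  by (metis add_0_right set_plus_intro subsetI)

text \<open>Segment by segment: each one adds at least as much to the larger of the two
  bodies.\<close>

lemma vol_supermodular_zonotope:
  assumes "compact_convex A" "compact_convex C" "0 \<in> C"
  shows "vol (A + C) - vol A \<le> vol (A + C + zonotope vs) - vol (A + zonotope vs)"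
proof (induction vs)
  case (Cons v vs)
  have "A + zonotope vs \<subseteq> (A + zonotope vs) + C" using assms by (intro set_plus_mono_zero)
  then have "vol (A + zonotope vs + seg v) - vol (A + zonotope vs)
      \<le> vol (A + zonotope vs + C + seg v) - vol (A + zonotope vs + C)"
    using assms by (intro vol_seg_mono compact_convex_plus) auto
  with Cons show ?case by (simp add: ac_simps)
qed simp

section \<open>Dilations of convex sets\<close>

lemma vol_scale:
  fixes A :: "'a::euclidean_space set"
  assumes "compact_convex A" "0 \<le> c"
  shows "vol ((*\<^sub>R) c ` A) = c ^ DIM('a) * vol A"
proof -
  have "measure lebesgue ((*\<^sub>R) c ` A) = \<bar>c\<bar> ^ DIM('a) * measure lebesgue A"
    using measure_lebesgue_affine[of c 0 A] by simp
  then show ?thesis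
    using assms compact_convex_scale[OF assms(1), of c] by (simp add: measure_completion compact_convex_borel)
qed

lemma scale_plus: "(*\<^sub>R) c ` (A + B) = (*\<^sub>R) c ` A + (*\<^sub>R) c ` (B :: 'a::real_vector set)"
  by (intro linear_image_plus linear_scaleR)

lemma scale_scale: "(*\<^sub>R) c ` (*\<^sub>R) d ` A = (*\<^sub>R) (c * d) ` (A :: 'a::real_vector set)"
  by (simp add: image_image)

lemma scale_add_convex:
  fixes A :: "'a::real_vector set"
  assumes "convex A" "0 \<le> a" "0 \<le> b"
  shows "(*\<^sub>R) (a + b) ` A = (*\<^sub>R) a ` A + (*\<^sub>R) b ` A"
proof (intro subset_antisym subsetI)
  fix x assume "x \<in> (*\<^sub>R) (a + b) ` A"
  then show "x \<in> (*\<^sub>R) a ` A + (*\<^sub>R) b ` A" by (auto simp: scaleR_add_left)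
next
  fix x assume "x \<in> (*\<^sub>R) a ` A + (*\<^sub>R) b ` A"
  then obtain y z where yz: "y \<in> A" "z \<in> A" "x = a *\<^sub>R y + b *\<^sub>R z"
    by (auto simp: set_plus_def)
  show "x \<in> (*\<^sub>R) (a + b) ` A"
  proof (cases "a + b = 0")
    case True
    then show ?thesis using yz assms by (auto intro!: image_eqI[of _ _ y] simp: add_nonneg_eq_0_iff)
  next
    case False
    then have "(a / (a + b)) *\<^sub>R y + (b / (a + b)) *\<^sub>R z \<in> A"
      using assms yz by (intro convexD) (auto simp: add_divide_distrib[symmetric])
    moreover have "x = (a + b) *\<^sub>R ((a / (a + b)) *\<^sub>R y + (b / (a + b)) *\<^sub>R z)"
      using False yz by (simp add: scaleR_add_right)
    ultimately show ?thesis by blast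
  qed
qed

lemma subset_scale:
  fixes A :: "'a::real_vector set"
  assumes "convex A" "0 \<in> A" "1 \<le> c"
  shows "A \<subseteq> (*\<^sub>R) c ` A"
proof
  fix x assume x: "x \<in> A"
  have "(1 / c) *\<^sub>R x + (1 - 1 / c) *\<^sub>R 0 \<in> A"
    using assms x by (intro convexD) auto
  then show "x \<in> (*\<^sub>R) c ` A" using assms by (intro image_eqI[of _ _ "(1 / c) *\<^sub>R x"]) auto
qed

text \<open>Closeness is measured by dilation instead of Hausdorff distance because volumes and
  shadows of dilates are explicit: limits become limits of powers of \<open>1 + \<epsilon>\<close>.
  Degenerate sets qualify, among them the projection of the ball into a hyperplane.\<close>

definition zonoid :: "'a::euclidean_space set \<Rightarrow> bool" where
  "zonoid E \<longleftrightarrow> compact_convex E \<and>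
     (\<forall>\<epsilon>>0. \<exists>vs. E \<subseteq> zonotope vs \<and> zonotope vs \<subseteq> (*\<^sub>R) (1 + \<epsilon>) ` E)"

lemma zonoid_compact_convex: "zonoid E \<Longrightarrow> compact_convex E"
  by (simp add: zonoid_def)

lemma zonoid_zero: "zonoid E \<Longrightarrow> 0 \<in> E"
proof -
  assume "zonoid E"
  then obtain vs where "zonotope vs \<subseteq> (*\<^sub>R) (1 + 1) ` E" unfolding zonoid_def by (metis zero_less_one)
  then have "0 \<in> (*\<^sub>R) (1 + 1) ` E" using zero_in_zonotope by blast
  then show ?thesis by auto
qed

lemma zonoid_linear_image:
  assumes f: "linear f" and E: "zonoid E"
  shows "zonoid (f ` E)"
  unfolding zonoid_def
proof (intro conjI allI impI)
  show "compact_convex (f ` E)" using assms by (intro compact_convex_linear_image) (auto simp: zonoid_def)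
  fix \<epsilon> :: real assume "0 < \<epsilon>"
  then obtain vs where vs: "E \<subseteq> zonotope vs" "zonotope vs \<subseteq> (*\<^sub>R) (1 + \<epsilon>) ` E"
    using E unfolding zonoid_def by metis
  have "f ` (*\<^sub>R) (1 + \<epsilon>) ` E = (*\<^sub>R) (1 + \<epsilon>) ` f ` E"
    using f by (simp add: image_image linear_scale)
  then show "\<exists>vs. f ` E \<subseteq> zonotope vs \<and> zonotope vs \<subseteq> (*\<^sub>R) (1 + \<epsilon>) ` f ` E"
    using image_mono[OF vs(1), of f] image_mono[OF vs(2), of f]
    by (intro exI[of _ "map f vs"]) (simp add: linear_image_zonotope[OF f, symmetric])
qed

lemma zonoid_scale: "zonoid E \<Longrightarrow> zonoid ((*\<^sub>R) c ` E)"
  by (intro zonoid_linear_image linear_scaleR)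

lemma le_of_tendsto_at_right:
  fixes f :: "real \<Rightarrow> real"
  assumes "\<And>\<epsilon>. 0 < \<epsilon> \<Longrightarrow> x \<le> f \<epsilon>" "(f \<longlongrightarrow> l) (at_right 0)"
  shows "x \<le> l"
  using assms by (intro tendsto_lowerbound[OF assms(2)]) (auto simp: eventually_at_right_less intro: eventually_mono[OF eventually_at_right_less])

lemma le_of_tendsto_at_right':
  fixes f :: "real \<Rightarrow> real"
  assumes "\<And>s. 0 < s \<Longrightarrow> f s \<le> g s" "(f \<longlongrightarrow> x) (at_right 0)" "(g \<longlongrightarrow> y) (at_right 0)"
  shows "x \<le> y"
proof (rule tendsto_le[OF trivial_limit_at_right_real assms(3,2)])
  show "\<forall>\<^sub>F s in at_right 0. f s \<le> g s"
    using eventually_at_right_less[of 0] by eventually_elim (rule assms(1))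
qed

text \<open>The approximating zonotope is squeezed between \<open>E\<close> and a dilate. As
  \<open>A + C\<close> contains 0, it lies in its own dilate, so the upper bound is a dilate of all
  of \<open>A + C + E\<close>, whose volume is explicit.\<close>

lemma vol_supermodular_zonoid:
  fixes A :: "'a::euclidean_space set"
  assumes A: "compact_convex A" "0 \<in> A" and C: "compact_convex C" "0 \<in> C" and E: "zonoid E"
  shows "vol (A + C) - vol A \<le> vol (A + C + E) - vol (A + E)"
proof (rule le_of_tendsto_at_right)
  show "((\<lambda>\<epsilon>. (1 + \<epsilon>) ^ DIM('a) * vol (A + C + E) - vol (A + E)) \<longlongrightarrow> vol (A + C + E) - vol (A + E)) (at_right 0)"
    by (auto intro!: tendsto_eq_intros)
  fix \<epsilon> :: real assume \<epsilon>: "0 < \<epsilon>"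
  then obtain vs where vs: "E \<subseteq> zonotope vs" "zonotope vs \<subseteq> (*\<^sub>R) (1 + \<epsilon>) ` E"
    using E unfolding zonoid_def by metis
  have AC: "compact_convex (A + C)" "0 \<in> A + C"
    using A C by (auto intro: compact_convex_plus zero_in_set_plus)
  note cE = zonoid_compact_convex[OF E]
  have ACE: "compact_convex (A + C + E)" using A C cE by (intro compact_convex_plus)
  have "vol (A + C + zonotope vs) \<le> vol ((*\<^sub>R) (1 + \<epsilon>) ` (A + C + E))"
    unfolding scale_plus[of _ "A + C"]
    using AC cE \<epsilon> vs A C
    by (intro vol_mono compact_convex_plus[of "A + C"] compact_convex_plus[of "(*\<^sub>R) c ` (A + C)" for c]
        compact_convex_scale set_plus_mono2 subset_scale compact_convex_zonotope)
       (simp_all add: compact_convexD)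
  also have "\<dots> = (1 + \<epsilon>) ^ DIM('a) * vol (A + C + E)"
    using ACE \<epsilon> by (intro vol_scale) auto
  finally have 1: "vol (A + C + zonotope vs) \<le> (1 + \<epsilon>) ^ DIM('a) * vol (A + C + E)" .
  have "vol (A + E) \<le> vol (A + zonotope vs)"
    using A cE vs by (intro vol_mono compact_convex_plus set_plus_mono2) auto
  with 1 vol_supermodular_zonotope[OF A(1) C, of vs]
  show "vol (A + C) - vol A \<le> (1 + \<epsilon>) ^ DIM('a) * vol (A + C + E) - vol (A + E)" by simp
qed

text \<open>Supermodularity for the dilates of \<open>E\<close> by \<open>a\<close> and
  \<open>b\<close>; convexity merges them into the dilate by \<open>a + b\<close>.\<close>

lemma vol_zonoid_superadditive:
  assumes A: "compact_convex A" "0 \<in> A" and E: "zonoid E" and "0 \<le> a" "0 \<le> b"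
  shows "(vol (A + (*\<^sub>R) a ` E) - vol A) + (vol (A + (*\<^sub>R) b ` E) - vol A)
    \<le> vol (A + (*\<^sub>R) (a + b) ` E) - vol A"
proof -
  have "vol (A + (*\<^sub>R) a ` E) - vol A \<le> vol (A + (*\<^sub>R) a ` E + (*\<^sub>R) b ` E) - vol (A + (*\<^sub>R) b ` E)"
    using assms by (intro vol_supermodular_zonoid)
      (auto intro: zonoid_scale compact_convex_scale zonoid_compact_convex zonoid_zero zero_in_scale)
  also have "A + (*\<^sub>R) a ` E + (*\<^sub>R) b ` E = A + (*\<^sub>R) (a + b) ` E"
    using assms by (simp add: scale_add_convex compact_convexD zonoid_compact_convex add.assoc)
  finally show ?thesis by simp
qed

text \<open>A continuous version of Fekete's lemma.\<close>
lemma superadditive_slope_at_right: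
  fixes \<psi> :: "real \<Rightarrow> real"
  assumes super: "\<And>a b. 0 \<le> a \<Longrightarrow> 0 \<le> b \<Longrightarrow> \<psi> a + \<psi> b \<le> \<psi> (a + b)"
    and nonneg: "\<And>t. 0 \<le> t \<Longrightarrow> 0 \<le> \<psi> t"
  obtains L where "0 \<le> L" "((\<lambda>t. \<psi> t / t) \<longlongrightarrow> L) (at_right 0)" "\<And>t. 0 < t \<Longrightarrow> L * t \<le> \<psi> t"
proof -
  define L where "L = (INF t\<in>{0<..}. \<psi> t / t)"
  have bdd: "bdd_below ((\<lambda>t. \<psi> t / t) ` {0<..})"
    by (intro bdd_belowI2[of _ 0]) (auto intro!: divide_nonneg_nonneg nonneg)
  have le: "L \<le> \<psi> t / t" if "0 < t" for t
    unfolding L_def using that by (intro cINF_lower bdd) auto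
  have L0: "0 \<le> L" unfolding L_def by (intro cINF_greatest) (auto intro!: divide_nonneg_nonneg nonneg)
  have mono: "\<psi> a \<le> \<psi> b" if "0 \<le> a" "a \<le> b" for a b
    using super[of a "b - a"] nonneg[of "b - a"] that by simp
  have mult: "real k * \<psi> s \<le> \<psi> (real k * s)" if "0 \<le> s" for k s
  proof (induction k)
    case 0 show ?case using nonneg[of 0] by simp
  next
    case (Suc k)
    then show ?case using super[of s "real k * s"] that by (simp add: algebra_simps)
  qed
  \<comment> \<open>\<open>k\<close> steps of length \<open>s\<close> come within \<open>s\<close>
    of \<open>t\<close>, so the slope at \<open>s\<close> exceeds the slope at \<open>t\<close> at
    most by the factor \<open>t / (t - s)\<close>, which tends to 1 as \<open>s\<close> tends to
    0.\<close>
  have slope: "\<psi> s / s \<le> \<psi> t / (t - s)" if s: "0 < s" "s < t" for s t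
  proof -
    define k where "k = nat \<lfloor>t / s\<rfloor>"
    have "0 \<le> \<lfloor>t / s\<rfloor>" using s by simp
    then have k: "real k \<le> t / s" "t / s < real k + 1" unfolding k_def by linarith+
    then have ks: "real k * s \<le> t" "t - s < real k * s" using s by (auto simp: field_simps)
    have "(t - s) * \<psi> s \<le> (real k * s) * \<psi> s" using ks nonneg[of s] s by (intro mult_right_mono) auto
    also have "\<dots> = s * (real k * \<psi> s)" by simp
    also have "\<dots> \<le> s * \<psi> (real k * s)" using mult[of s k] s by (intro mult_left_mono) auto
    also have "\<dots> \<le> s * \<psi> t" using mono[of "real k * s" t] ks s by (intro mult_left_mono) auto
    finally show ?thesis using s by (simp add: field_simps)
  qed
  have "((\<lambda>t. \<psi> t / t) \<longlongrightarrow> L) (at_right 0)"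
  proof (rule order_tendstoI)
    fix a assume "a < L"
    then show "\<forall>\<^sub>F t in at_right 0. a < \<psi> t / t"
      by (intro eventually_mono[OF eventually_at_right_less[of 0]]) (auto intro: less_le_trans le)
  next
    fix a assume "L < a"
    then obtain t where t: "0 < t" "\<psi> t / t < a"
      unfolding L_def using bdd by (subst (asm) cINF_less_iff) auto
    have "((\<lambda>s. \<psi> t / (t - s)) \<longlongrightarrow> \<psi> t / (t - 0)) (at_right 0)"
      using t by (intro tendsto_intros) auto
    then have "\<forall>\<^sub>F s in at_right 0. \<psi> t / (t - s) < a"
      using t by (intro order_tendstoD(2)) auto
    moreover have "\<forall>\<^sub>F s in at_right (0::real). 0 < s \<and> s < t"
      using t by (intro eventually_at_right_field[THEN iffD2]) auto
    ultimately show "\<forall>\<^sub>F s in at_right 0. \<psi> s / s < a"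
      by eventually_elim (use slope in \<open>auto intro: le_less_trans\<close>)
  qed
  then show thesis using that L0 le by (auto simp: field_simps)
qed

lemma vol_zonoid_slope:
  assumes A: "compact_convex A" "0 \<in> A" and E: "zonoid E"
  obtains L where "0 \<le> L" "((\<lambda>t. (vol (A + (*\<^sub>R) t ` E) - vol A) / t) \<longlongrightarrow> L) (at_right 0)"
    "\<And>t. 0 < t \<Longrightarrow> L * t \<le> vol (A + (*\<^sub>R) t ` E) - vol A"
proof -
  have "0 \<le> vol (A + (*\<^sub>R) t ` E) - vol A" if "0 \<le> t" for t
  proof -
    have "A \<subseteq> A + (*\<^sub>R) t ` E"
      using zonoid_zero[OF E] by (intro set_plus_mono_zero zero_in_scale)
    then have "vol A \<le> vol (A + (*\<^sub>R) t ` E)"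
      using A zonoid_compact_convex[OF E] by (intro vol_mono compact_convex_plus compact_convex_scale)
    then show ?thesis by simp
  qed
  with vol_zonoid_superadditive[OF assms] show thesis
    by (rule superadditive_slope_at_right) (assumption | rule that)+
qed

text \<open>\<open>Lim\<close> carries information only once convergence is shown; this is the
  bridge from the slopes to the surface areas.\<close>

lemma first_variation_eqI:
  assumes "((\<lambda>t. (measure \<mu> (A + (*\<^sub>R) t ` U) - measure \<mu> A) / t) \<longlongrightarrow> L) (at_right 0)"
  shows "first_variation \<mu> A U = L"
proof -
  have "{x + t *\<^sub>R y | x y. x \<in> A \<and> y \<in> U} = A + (*\<^sub>R) t ` U" for t
    by (auto simp: set_plus_def)
  then show ?thesis unfolding first_variation_def using assms by (simp add: tendsto_Lim)
qed

lemma surface_area_slope: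
  fixes A :: "'a::euclidean_space set"
  assumes A: "compact_convex A" "0 \<in> A" and ball: "zonoid (cball (0::'a) 1)"
  shows "((\<lambda>t. (vol (A + (*\<^sub>R) t ` cball 0 1) - vol A) / t) \<longlongrightarrow> surface_area A) (at_right 0)" (is ?lim)
    and "0 < t \<Longrightarrow> surface_area A * t \<le> vol (A + (*\<^sub>R) t ` cball 0 1) - vol A" (is "_ \<Longrightarrow> ?le t")
proof -
  obtain L where "0 \<le> L" and L: "((\<lambda>t. (vol (A + (*\<^sub>R) t ` cball 0 1) - vol A) / t) \<longlongrightarrow> L) (at_right 0)"
    "\<And>t. 0 < t \<Longrightarrow> L * t \<le> vol (A + (*\<^sub>R) t ` cball 0 1) - vol A"
    by (rule vol_zonoid_slope[OF A ball]) (rule that)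
  have "surface_area A = L" unfolding surface_area_def by (rule first_variation_eqI[OF L(1)])
  with L show ?lim "0 < t \<Longrightarrow> ?le t" by auto
qed

section \<open>Surface area inside a hyperplane\<close>

lemma norm_perp_proj_le:
  assumes "norm \<xi> = 1"
  shows "norm (perp_proj \<xi> x) \<le> norm x"
proof -
  have "(norm x)\<^sup>2 = (norm (perp_proj \<xi> x))\<^sup>2 + (norm ((\<xi> \<bullet> x) *\<^sub>R \<xi>))\<^sup>2"
    using perp_proj_in_perp[of \<xi> x]
    by (subst (1) perp_proj_decomp[OF assms]) (rule norm_add_Pythagorean, auto simp: orthogonal_def perp_def inner_commute)
  then have "(norm (perp_proj \<xi> x))\<^sup>2 \<le> (norm x)\<^sup>2" by simp
  then show ?thesis by (rule power2_le_imp_le) simp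
qed

lemma perp_proj_cball:
  fixes \<xi> :: "'a::euclidean_space"
  assumes "norm \<xi> = 1"
  shows "perp_proj \<xi> ` cball 0 1 = cball 0 1 \<inter> perp \<xi>"
proof (intro subset_antisym subsetI)
  fix y assume "y \<in> perp_proj \<xi> ` cball 0 1"
  then obtain x where x: "norm x \<le> 1" "y = perp_proj \<xi> x" by auto
  then show "y \<in> cball 0 1 \<inter> perp \<xi>"
    using norm_perp_proj_le[OF assms, of x] perp_proj_in_perp[of \<xi> x] by auto
next
  fix y assume "y \<in> cball 0 1 \<inter> perp \<xi>"
  then show "y \<in> perp_proj \<xi> ` cball 0 1" by (intro image_eqI[of _ _ y]) (auto simp: perp_proj_id)
qed

text \<open>\<open>A'\<close> is the cylinder of height 1 over the projection of \<open>A\<close>.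
  Adding the projected ball to it gives the cylinder over the projection of the enlarged body, so
  slopes of the volume in the ambient space are slopes of the shadow.\<close>

lemma surface_area_in_shadow:
  fixes A :: "'a::euclidean_space set"
  assumes A: "compact_convex A" "0 \<in> A" and ball: "zonoid (cball (0::'a) 1)" and \<xi>: "norm \<xi> = 1"
  shows "0 \<le> surface_area_in (perp \<xi>) (perp_proj \<xi> ` A)"
    and "0 < t \<Longrightarrow> surface_area_in (perp \<xi>) (perp_proj \<xi> ` A) * t
      \<le> shadow \<xi> (A + (*\<^sub>R) t ` cball 0 1) - shadow \<xi> A" (is "_ \<Longrightarrow> ?le t")
proof -
  let ?P = "perp_proj \<xi>" and ?s = "seg ((1/2) *\<^sub>R \<xi>)"
  note lin = linear_perp_proj[of \<xi>]
  define A' where "A' = ?P ` A + ?s"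
  have A'c: "compact_convex A'"
    unfolding A'_def using A(1)
    by (intro compact_convex_plus compact_convex_linear_image[OF lin] compact_convex_seg)
  have A'0: "0 \<in> A'"
    unfolding A'_def using A(2) by (intro zero_in_set_plus zero_in_linear_image[OF lin] zero_in_seg)
  have P_scale: "?P ` (*\<^sub>R) t ` B = (*\<^sub>R) t ` ?P ` B" for t B
    by (simp add: image_image linear_scale[OF lin])
  have sh: "shadow \<xi> (A + (*\<^sub>R) t ` cball 0 1) = vol (A' + (*\<^sub>R) t ` ?P ` cball 0 1)" for t
    unfolding shadow_eq_vol[OF compact_convex_plus[OF A(1) compact_convex_scale[OF compact_convex_cball]] \<xi>]
      A'_def linear_image_plus[OF lin] P_scale
    by (simp only: ac_simps)
  have sh0: "shadow \<xi> A = vol A'" unfolding A'_def by (rule shadow_eq_vol[OF A(1) \<xi>])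
  obtain L where L: "0 \<le> L" "((\<lambda>t. (vol (A' + (*\<^sub>R) t ` ?P ` cball 0 1) - vol A') / t) \<longlongrightarrow> L) (at_right 0)"
    "\<And>t. 0 < t \<Longrightarrow> L * t \<le> vol (A' + (*\<^sub>R) t ` ?P ` cball 0 1) - vol A'"
    by (rule vol_zonoid_slope[OF A'c A'0 zonoid_linear_image[OF lin ball]]) (rule that)
  have "?P ` A + (*\<^sub>R) t ` (cball 0 1 \<inter> perp \<xi>) = ?P ` (A + (*\<^sub>R) t ` cball 0 1)" for t
    unfolding perp_proj_cball[OF \<xi>, symmetric] linear_image_plus[OF lin] P_scale ..
  then have "((\<lambda>t. (measure (subspace_lborel (perp \<xi>)) (?P ` A + (*\<^sub>R) t ` (cball 0 1 \<inter> perp \<xi>))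
      - measure (subspace_lborel (perp \<xi>)) (?P ` A)) / t) \<longlongrightarrow> L) (at_right 0)"
    using L(2) unfolding sh[symmetric] sh0[symmetric] shadow_def by presburger
  then have "surface_area_in (perp \<xi>) (?P ` A) = L"
    unfolding surface_area_in_def by (rule first_variation_eqI)
  note eq = this
  show "0 \<le> surface_area_in (perp \<xi>) (?P ` A)" unfolding eq by (rule L(1))
  show "0 < t \<Longrightarrow> ?le t" unfolding sh sh0 eq by (rule L(3))
qed

subsection \<open>Volumes of zonotopes\<close>

text \<open>Each segment adds at least what it would add to \<open>A\<close> alone.\<close>

lemma vol_plus_zonotope_ge:
  assumes A: "compact_convex A"
  shows "vol A + (\<Sum>v\<leftarrow>vs. 2 * norm v * shadow (sgn v) A) \<le> vol (A + zonotope vs)"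
proof (induction vs)
  case (Cons v vs)
  have "vol (A + seg v) - vol A \<le> vol (A + zonotope vs + seg v) - vol (A + zonotope vs)"
    using A by (intro vol_seg_mono compact_convex_plus set_plus_mono_zero) auto
  with Cons show ?case by (simp add: vol_plus_seg_sgn[OF A] ac_simps)
qed simp

lemma vol_plus_zonotope_le:
  assumes A: "compact_convex A"
  shows "vol (A + zonotope vs) \<le> vol A + (\<Sum>v\<leftarrow>vs. 2 * norm v * shadow (sgn v) (A + zonotope vs))"
proof -
  \<comment> \<open>Each segment adds at most what it would add to the final body. The induction
    needs that body held fixed, hence a \<open>B\<close> that merely contains the sum.\<close>
  have "vol (A + zonotope vs) \<le> vol A + (\<Sum>v\<leftarrow>vs. vol (B + seg v) - vol B)"
    if B: "compact_convex B" "A + zonotope vs \<subseteq> B" for B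
    using B(2)
  proof (induction vs)
    case (Cons v vs)
    have sub: "A + zonotope vs \<subseteq> A + zonotope (v # vs)"
      using set_plus_mono_zero[OF zero_in_seg, of "A + zonotope vs" v] by (simp add: ac_simps)
    have "vol (A + zonotope vs + seg v) - vol (A + zonotope vs) \<le> vol (B + seg v) - vol B"
      using A B(1) sub Cons.prems by (intro vol_seg_mono compact_convex_plus) auto
    moreover have "vol (A + zonotope vs) \<le> vol A + (\<Sum>v\<leftarrow>vs. vol (B + seg v) - vol B)"
      using sub Cons.prems by (intro Cons.IH) auto
    ultimately show ?case by (simp add: ac_simps)
  qed simp
  from this[OF compact_convex_plus[OF A compact_convex_zonotope] subset_refl]
  show ?thesis
    using A by (simp add: vol_plus_seg_sgn[OF compact_convex_plus[OF A compact_convex_zonotope]])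
qed

text \<open>Dilating \<open>A\<close> plus a segment of half-length \<open>1 / c\<close> gives the
  dilate of \<open>A\<close> plus a segment of half-length 1; comparing the volumes, one factor
  \<open>c\<close> cancels.\<close>

lemma shadow_scale:
  fixes A :: "'a::euclidean_space set"
  assumes A: "compact_convex A" and \<xi>: "norm \<xi> = 1" and c: "0 < c"
  shows "shadow \<xi> ((*\<^sub>R) c ` A) = c ^ (DIM('a) - 1) * shadow \<xi> A"
proof -
  have "(*\<^sub>R) c ` (A + seg ((1 / c) *\<^sub>R \<xi>)) = (*\<^sub>R) c ` A + seg (1 *\<^sub>R \<xi>)"
    unfolding scale_plus using c by (simp add: linear_image_seg[OF linear_scaleR])
  then have "vol ((*\<^sub>R) c ` A) + 2 * 1 * shadow \<xi> ((*\<^sub>R) c ` A) = c ^ DIM('a) * vol (A + seg ((1 / c) *\<^sub>R \<xi>))"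
    using vol_plus_seg[OF compact_convex_scale[OF A] \<xi>, of 1 c]
      vol_scale[OF compact_convex_plus[OF A compact_convex_seg[of "(1 / c) *\<^sub>R \<xi>"]], of c] c by simp
  also have "\<dots> = c ^ DIM('a) * vol A + c ^ DIM('a) * (2 * (1 / c) * shadow \<xi> A)"
    using vol_plus_seg[OF A \<xi>, of "1 / c"] c by (simp add: distrib_left)
  also have "c ^ DIM('a) = c * c ^ (DIM('a) - 1)"
    by (simp add: power_eq_if)
  finally show ?thesis using vol_scale[OF A, of c] c by (simp add: power_eq_if field_simps)
qed

lemma zonotope_scale: "zonotope (map ((*\<^sub>R) c) vs) = (*\<^sub>R) c ` zonotope vs"
  by (simp add: linear_image_zonotope[OF linear_scaleR])

lemma shadow_sgn_scale:
  fixes A :: "'a::euclidean_space set"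
  assumes "compact_convex A" "0 < c"
  shows "norm v * shadow (sgn v) ((*\<^sub>R) c ` A) = c ^ (DIM('a) - 1) * (norm v * shadow (sgn v) A)"
  using assms by (cases "v = 0") (auto simp: shadow_scale norm_sgn)

lemma sgn_scaleR_pos: "0 < c \<Longrightarrow> sgn (c *\<^sub>R v) = sgn (v :: 'a::real_normed_vector)"
  by (simp add: sgn_div_norm)

text \<open>The dilate of the zonotope by \<open>1 + s\<close> arises by adding all its segments
  scaled by \<open>s\<close>. Its volume is known from homogeneity and bounded by the increments;
  the two are compared to first order in \<open>s\<close>.\<close>

lemma vol_zonotope_le_shadows:
  fixes vs :: "'a::euclidean_space list"
  shows "DIM('a) * vol (zonotope vs) \<le> (\<Sum>v\<leftarrow>vs. 2 * norm v * shadow (sgn v) (zonotope vs))"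
    (is "_ \<le> ?S")
proof (rule le_of_tendsto_at_right)
  let ?W = "zonotope vs" and ?n = "DIM('a)"
  show "((\<lambda>s. (1 + s) ^ (?n - 1) * ?S) \<longlongrightarrow> ?S) (at_right 0)"
    by (auto intro!: tendsto_eq_intros)
  fix s :: real assume s: "0 < s"
  have "(1 + s) ^ ?n * vol ?W = vol ((*\<^sub>R) (1 + s) ` ?W)"
    using s by (simp add: vol_scale)
  also have sW: "(*\<^sub>R) (1 + s) ` ?W = ?W + zonotope (map ((*\<^sub>R) s) vs)"
    using s scale_add_convex[of ?W 1 s] by (simp add: zonotope_scale compact_convexD)
  also have "vol \<dots> \<le> vol ?W + (\<Sum>v\<leftarrow>map ((*\<^sub>R) s) vs. 2 * norm v * shadow (sgn v) (?W + zonotope (map ((*\<^sub>R) s) vs)))"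
    by (intro vol_plus_zonotope_le) simp
  also have "(\<Sum>v\<leftarrow>map ((*\<^sub>R) s) vs. 2 * norm v * shadow (sgn v) (?W + zonotope (map ((*\<^sub>R) s) vs)))
      = s * ((1 + s) ^ (?n - 1) * ?S)"
    using s unfolding sW[symmetric]
    by (simp add: o_def sgn_scaleR_pos sum_list_const_mult[symmetric] mult.assoc shadow_sgn_scale mult.left_commute)
  finally have 1: "(1 + s) ^ ?n * vol ?W \<le> vol ?W + s * ((1 + s) ^ (?n - 1) * ?S)" .
  have "1 + real ?n * s \<le> (1 + s) ^ ?n" using s by (intro Bernoulli_inequality) auto
  then have "(1 + real ?n * s) * vol ?W \<le> (1 + s) ^ ?n * vol ?W" by (intro mult_right_mono) auto
  with 1 have "s * (?n * vol ?W) \<le> s * ((1 + s) ^ (?n - 1) * ?S)" by (simp add: algebra_simps)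
  then show "?n * vol ?W \<le> (1 + s) ^ (?n - 1) * ?S" using s by simp
qed

section \<open>The volume of a zonotope against the total length of its segments\<close>

definition orthonormal_list :: "'a::real_inner list \<Rightarrow> bool" where
  "orthonormal_list us \<longleftrightarrow> distinct us \<and> pairwise orthogonal (set us) \<and> (\<forall>u\<in>set us. norm u = 1)"

lemma orthonormal_list_independent: "orthonormal_list us \<Longrightarrow> independent (set us)"
  by (intro pairwise_orthogonal_independent) (auto simp: orthonormal_list_def)

lemma length_orthonormal_list_le:
  "orthonormal_list us \<Longrightarrow> length us \<le> DIM('a)" for us :: "'a::euclidean_space list"
  using independent_bound[OF orthonormal_list_independent, of us]
  by (simp add: orthonormal_list_def distinct_card)

lemma orthonormal_list_Cons:
  assumes "orthonormal_list us" "norm \<xi> = 1" "\<And>u. u \<in> set us \<Longrightarrow> \<xi> \<bullet> u = 0"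
  shows "orthonormal_list (\<xi> # us)"
proof -
  have "\<xi> \<notin> set us" using assms(2) assms(3)[of \<xi>] by (auto simp: dot_square_norm)
  then show ?thesis
    using assms by (auto simp: orthonormal_list_def pairwise_insert orthogonal_def inner_commute)
qed

lemma zonotope_inner_bound:
  "x \<in> zonotope vs \<Longrightarrow> \<bar>x \<bullet> u\<bar> \<le> (\<Sum>v\<leftarrow>vs. \<bar>v \<bullet> u\<bar>)"
proof (induction vs arbitrary: x)
  case (Cons v vs)
  then obtain t y where x: "x = t *\<^sub>R v + y" "\<bar>t\<bar> \<le> 1" "y \<in> zonotope vs"
    by (auto simp: set_plus_def seg_def abs_le_iff)
  have "\<bar>x \<bullet> u\<bar> \<le> \<bar>t\<bar> * \<bar>v \<bullet> u\<bar> + \<bar>y \<bullet> u\<bar>"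
    unfolding x(1) inner_add_left inner_scaleR_left abs_mult[symmetric] by (rule abs_triangle_ineq)
  also have "\<dots> \<le> 1 * \<bar>v \<bullet> u\<bar> + (\<Sum>v\<leftarrow>vs. \<bar>v \<bullet> u\<bar>)"
    using x Cons.IH by (intro add_mono mult_right_mono) auto
  finally show ?case by simp
qed simp

text \<open>In coordinates with respect to \<open>us\<close>, which preserve Lebesgue measure, the
  cube lies in a box with sides \<open>{-1/2..1/2}\<close>.\<close>

lemma vol_orthonormal_cube_le:
  fixes us :: "'a::euclidean_space list"
  assumes us: "orthonormal_list us" "length us = DIM('a)"
  shows "vol (zonotope (map ((*\<^sub>R) (1/2)) us)) \<le> 1"
proof -
  interpret product_sigma_finite "\<lambda>_. lborel :: real measure" ..
  let ?Q = "zonotope (map ((*\<^sub>R) (1/2)) us)" and ?B = "set us" and ?f = "\<lambda>f. \<Sum>b\<in>set us. f b *\<^sub>R b"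
  have "span ?B = UNIV"
    using dim_eq_card_independent[OF orthonormal_list_independent[OF us(1)]] us
    by (simp add: orthonormal_list_def distinct_card flip: dim_eq_full)
  then have B: "orthonormal_basis_of UNIV ?B"
    using us by (auto simp: orthonormal_basis_of_def orthonormal_list_def)
  note ip = orthonormal_basis_ofD(5)[OF B]
  have sub: "?f -` ?Q \<inter> space (\<Pi>\<^sub>M b\<in>?B. lborel) \<subseteq> (\<Pi>\<^sub>E b\<in>?B. {-1/2..1/2::real})"
  proof
    fix f :: "'a \<Rightarrow> real" assume f: "f \<in> ?f -` ?Q \<inter> space (\<Pi>\<^sub>M b\<in>?B. lborel)"
    have "f b \<in> {-1/2..1/2}" if b: "b \<in> ?B" for b
    proof -
      have "?f f \<bullet> b = (\<Sum>c\<in>?B. if c = b then f c else 0)"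
        unfolding inner_sum_left using ip b by (intro sum.cong) auto
      also have "\<dots> = f b" using b by simp
      finally have "\<bar>f b\<bar> \<le> (\<Sum>v\<leftarrow>map ((*\<^sub>R) (1/2)) us. \<bar>v \<bullet> b\<bar>)"
        using zonotope_inner_bound[of "?f f" "map ((*\<^sub>R) (1/2)) us" b] f by simp
      also have "\<dots> = (\<Sum>v\<in>?B. \<bar>(1/2) * (v \<bullet> b)\<bar>)"
        using us by (simp add: orthonormal_list_def o_def sum_list_distinct_conv_sum_set)
      also have "\<dots> = (\<Sum>v\<in>?B. if v = b then 1/2 else 0)"
        using ip b by (intro sum.cong) auto
      also have "\<dots> = 1/2" using b by simp
      finally show ?thesis by auto
    qed
    then show "f \<in> (\<Pi>\<^sub>E b\<in>?B. {-1/2..1/2})" using f by (auto simp: space_PiM PiE_iff)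
  qed
  have "emeasure lborel ?Q = emeasure (distr (\<Pi>\<^sub>M b\<in>?B. lborel) borel ?f) ?Q"
    by (subst distr_PiM_orthonormal_basis_UNIV[OF B]) simp
  also have "\<dots> = emeasure (\<Pi>\<^sub>M b\<in>?B. lborel) (?f -` ?Q \<inter> space (\<Pi>\<^sub>M b\<in>?B. lborel))"
    by (rule emeasure_distr) (auto intro: compact_convex_borel)
  also have "\<dots> \<le> emeasure (\<Pi>\<^sub>M b\<in>?B. lborel) (\<Pi>\<^sub>E b\<in>?B. {-1/2..1/2::real})"
    by (intro emeasure_mono[OF sub] sets_PiM_I_finite) auto
  also have "\<dots> = 1"
    by (subst emeasure_PiM) auto
  finally show ?thesis
    by (simp add: measure_def enn2real_leI)
qed

lemma zonotope_subset_span: "zonotope vs \<subseteq> span (set vs)"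
proof (induction vs)
  case (Cons v vs)
  have "t *\<^sub>R v + y \<in> span (set (v # vs))" if "y \<in> zonotope vs" for t y
  proof (intro span_add span_scale)
    show "v \<in> span (set (v # vs))" by (intro span_base) simp
    show "y \<in> span (set (v # vs))" using that Cons span_mono[of "set vs" "set (v # vs)"] by auto
  qed
  then show ?case by (auto simp: set_plus_def seg_def)
qed simp

text \<open>Two terms of the binomial expansion: Bernoulli's inequality in a form that allows
  \<open>a = 0\<close>.\<close>

lemma add_power_ge:
  fixes a b :: real
  assumes "0 \<le> a" "0 \<le> b"
  shows "a ^ Suc m + (1 + real m) * b * a ^ m \<le> (a + b) ^ Suc m"
proof (induction m)
  case (Suc m)
  have "a ^ Suc (Suc m) + (1 + real (Suc m)) * b * a ^ Suc m
      \<le> (a + b) * (a ^ Suc m + (1 + real m) * b * a ^ m)"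
    using assms by (simp add: algebra_simps)
  also have "\<dots> \<le> (a + b) * (a + b) ^ Suc m" using Suc assms by (intro mult_left_mono) auto
  finally show ?case by simp
qed simp

text \<open>
  The orthonormal cube fills up the directions already projected away, so that the induction
  on the number of segments, which projects along one of them, stays in the ambient space.
\<close>
lemma vol_zonotope_cube_le:
  fixes us vs :: "'a::euclidean_space list"
  assumes "orthonormal_list us" "\<And>u v. u \<in> set us \<Longrightarrow> v \<in> set vs \<Longrightarrow> v \<bullet> u = 0"
  shows "vol (zonotope vs + zonotope (map ((*\<^sub>R) (1/2)) us))
    \<le> (2 * (\<Sum>v\<leftarrow>vs. norm v)) ^ (DIM('a) - length us) / fact (DIM('a) - length us)"
  using assms
proof (induction "length vs" arbitrary: us vs)
  case 0
  show ?case
  proof (cases "length us = DIM('a)")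
    \<comment> \<open>The bound reads \<open>0 ^ 0 / fact 0\<close>, which is 1.\<close>
    case True
    with 0 show ?thesis using vol_orthonormal_cube_le[of us] by simp
  next
    case False
    \<comment> \<open>Fewer than \<open>DIM('a)\<close> vectors span a null set, and the bound is a
      positive power of 0.\<close>
    let ?Q = "zonotope (map ((*\<^sub>R) (1/2)) us)"
    have "?Q \<subseteq> span (set us)"
    proof (rule subset_trans[OF zonotope_subset_span span_minimal])
      show "set (map ((*\<^sub>R) (1/2)) us) \<subseteq> span (set us)"
        using span_scale[OF span_base, of _ "set us"] by auto
    qed simp
    moreover have "dim (span (set us)) < DIM('a)"
      using False length_orthonormal_list_le[OF 0(2)] dim_le_card'[of "set us"] card_length[of us] by simp
    then have "negligible (span (set us))" by (intro negligible_lowdim) simp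
    ultimately have "negligible ?Q" using negligible_subset by blast
    then have "measure lebesgue ?Q = 0" by (rule negligible_imp_measure0)
    then have "vol ?Q = 0" by (simp add: measure_completion compact_convex_borel)
    then show ?thesis using 0(1) False length_orthonormal_list_le[OF 0(2)] by simp
  qed
next
  case (Suc N)
  then obtain v ws where vs: "vs = v # ws" "N = length ws" by (cases vs) auto
  let ?Q = "\<lambda>us. zonotope (map ((*\<^sub>R) (1/2)) us)" and ?n = "DIM('a)"
  let ?M = "\<Sum>v\<leftarrow>ws. norm v"
  have M0: "0 \<le> ?M" by (intro sum_list_nonneg) auto
  have IH: "vol (zonotope ws + ?Q us) \<le> (2 * ?M) ^ (?n - length us) / fact (?n - length us)"
    using Suc(1)[OF vs(2) Suc(3)] Suc(4) vs by simp
  show ?case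
  proof (cases "v = 0")
    case True
    then show ?thesis using IH by (simp add: vs)
  next
    case False
    define \<xi> where "\<xi> = sgn v"
    have \<xi>: "norm \<xi> = 1" using False by (simp add: \<xi>_def norm_sgn)
    have \<xi>u: "\<xi> \<bullet> u = 0" if "u \<in> set us" for u
      using Suc(4)[OF that, of v] by (simp add: \<xi>_def vs sgn_div_norm)
    let ?P = "perp_proj \<xi>"
    note lin = linear_perp_proj[of \<xi>]
    have o: "orthonormal_list (\<xi> # us)" by (rule orthonormal_list_Cons[OF Suc(3) \<xi> \<xi>u])
    define m where "m = ?n - length (\<xi> # us)"
    \<comment> \<open>As \<open>\<xi> # us\<close> is orthonormal, \<open>us\<close> does not yet
      fill the space and the subtraction is not truncated.\<close>
    have m: "?n - length us = Suc m" using length_orthonormal_list_le[OF o] by (simp add: m_def)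
    have PQ: "map ?P (map ((*\<^sub>R) (1/2)) us) = map ((*\<^sub>R) (1/2)) us"
      using \<xi>u by (auto simp: perp_proj_id perp_def)
    \<comment> \<open>The cylinder over the projection brings in a unit segment along
      \<open>\<xi>\<close>, which becomes a new edge of the cube; the vectors of \<open>us\<close>,
      orthogonal to \<open>\<xi>\<close>, are unchanged.\<close>
    have sh: "shadow \<xi> (zonotope ws + ?Q us) = vol (zonotope (map ?P ws) + ?Q (\<xi> # us))"
      unfolding shadow_eq_vol[OF compact_convex_plus[OF compact_convex_zonotope compact_convex_zonotope] \<xi>]
        linear_image_plus[OF lin] linear_image_zonotope[OF lin] PQ
      by (simp add: ac_simps)
    have "vol (zonotope (map ?P ws) + ?Q (\<xi> # us)) \<le> (2 * (\<Sum>v\<leftarrow>map ?P ws. norm v)) ^ m / fact m"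
      unfolding m_def
    proof (rule Suc(1))
      show "w \<bullet> u = 0" if "u \<in> set (\<xi> # us)" "w \<in> set (map ?P ws)" for u w
      proof -
        obtain x where x: "x \<in> set ws" "w = perp_proj \<xi> x" using \<open>w \<in> _\<close> by auto
        show ?thesis
        proof (cases "u = \<xi>")
          case True
          then show ?thesis using perp_proj_in_perp[of \<xi> x] by (simp add: x perp_def inner_commute)
        next
          case False
          then have "u \<in> set us" using that(1) by simp
          then show ?thesis
            using Suc(4)[of u x] \<xi>u[of u] x by (simp add: vs perp_proj_def inner_diff_left)
        qed
      qed
    qed (use o vs in auto)
    also have "\<dots> \<le> (2 * ?M) ^ m / fact m"
      using \<xi> by (intro divide_right_mono power_mono mult_left_mono)
        (auto simp: o_def intro!: sum_list_mono norm_perp_proj_le sum_list_nonneg)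
    finally have sh_le: "shadow \<xi> (zonotope ws + ?Q us) \<le> (2 * ?M) ^ m / fact m" unfolding sh .
    have "vol (zonotope vs + ?Q us) = vol ((zonotope ws + ?Q us) + seg v)"
      by (simp add: vs ac_simps)
    also have "\<dots> = vol (zonotope ws + ?Q us) + 2 * norm v * shadow \<xi> (zonotope ws + ?Q us)"
      unfolding \<xi>_def by (intro vol_plus_seg_sgn compact_convex_plus compact_convex_zonotope)
    \<comment> \<open>These are the first two terms of the Taylor expansion of the claimed bound:
      \<open>x ^ Suc m / fact (Suc m)\<close> has derivative \<open>x ^ m / fact m\<close>.\<close>
    also have "\<dots> \<le> (2 * ?M) ^ Suc m / fact (Suc m) + 2 * norm v * ((2 * ?M) ^ m / fact m)"
      using IH sh_le unfolding m by (intro add_mono mult_left_mono) auto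
    also have "\<dots> = ((2 * ?M) ^ Suc m + (1 + real m) * (2 * norm v) * (2 * ?M) ^ m) / fact (Suc m)"
    proof -
      have "x / ((1 + real m) * f) + b * (y / f) = (x + (1 + real m) * b * y) / ((1 + real m) * f)"
        if "0 < f" for x y b f :: real
      proof -
        have "1 + real m \<noteq> 0" by linarith
        with that show ?thesis by (simp add: divide_simps)
      qed
      from this[OF fact_gt_zero] show ?thesis by simp
    qed
    also have "\<dots> \<le> (2 * ?M + 2 * norm v) ^ Suc m / fact (Suc m)"
      using M0 by (intro divide_right_mono add_power_ge) auto
    finally show ?thesis unfolding m by (simp add: vs algebra_simps)
  qed
qed

lemma vol_zonotope_le:
  fixes vs :: "'a::euclidean_space list"
  shows "vol (zonotope vs) \<le> (2 * (\<Sum>v\<leftarrow>vs. norm v)) ^ DIM('a) / fact DIM('a)"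
  using vol_zonotope_cube_le[of "[]" vs] by (simp add: orthonormal_list_def)

subsection \<open>The squared distance to a convex body along a line\<close>

text \<open>A convex function with equal values at both ends falls to its minimum and rises again,
  so its total variation is twice the depth.\<close>

lemma has_integral_abs_deriv_valley:
  fixes g g' :: "real \<Rightarrow> real"
  assumes ab: "a \<le> b" and der: "\<And>x. (g has_real_derivative g' x) (at x)" and mono: "mono g'"
    and ends: "g a = M" "g b = M"
  obtains c where "c \<in> {a..b}" "\<And>x. x \<in> {a..b} \<Longrightarrow> g c \<le> g x"
    "((\<lambda>x. \<bar>g' x\<bar>) has_integral 2 * (M - g c)) {a..b}"
proof -
  have cont: "continuous_on {a..b} g" using der
    by (intro DERIV_continuous_on[of _ _ g']) (auto intro: has_field_derivative_at_within)
  obtain c where c: "c \<in> {a..b}" "\<And>x. x \<in> {a..b} \<Longrightarrow> g c \<le> g x"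
    using continuous_attains_inf[OF compact_Icc _ cont] ab by force
  have left: "g' x \<le> 0" if x: "a \<le> x" "x < c" for x
  proof (rule ccontr)
    assume "\<not> g' x \<le> 0"
    obtain z where z: "x < z" "z < c" "g c - g x = (c - x) * g' z"
      using MVT2[OF x(2) der] by auto
    have "0 < g' z" using \<open>\<not> g' x \<le> 0\<close> monoD[OF mono, of x z] z by simp
    then have "0 < (c - x) * g' z" using x by simp
    with z c(2)[of x] c(1) x show False by auto
  qed
  have right: "0 \<le> g' x" if x: "x \<le> b" "c < x" for x
  proof (rule ccontr)
    assume "\<not> 0 \<le> g' x"
    obtain z where z: "c < z" "z < x" "g x - g c = (x - c) * g' z"
      using MVT2[OF x(2) der] by auto
    have "g' z < 0" using \<open>\<not> 0 \<le> g' x\<close> monoD[OF mono, of z x] z by simp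
    then have "(x - c) * g' z < 0" using x by (simp add: mult_pos_neg)
    with z c(2)[of x] c(1) x show False by auto
  qed
  have ftc: "(g' has_integral g q - g p) {p..q}" if "p \<le> q" for p q
    using that der by (intro fundamental_theorem_of_calculus)
      (auto simp: has_real_derivative_iff_has_vector_derivative[symmetric] intro: has_field_derivative_at_within)
  have "((\<lambda>x. \<bar>g' x\<bar>) has_integral M - g c) {a..c}"
  \<comment> \<open>The sign of \<open>g'\<close> is known only away from \<open>c\<close>; a single
    point does not affect the integral.\<close>
  proof (rule has_integral_spike[of "{c}"])
    show "((\<lambda>x. - g' x) has_integral M - g c) {a..c}"
      using has_integral_neg[OF ftc[of a c]] c ends by simp
  qed (use left in force)+
  moreover have "((\<lambda>x. \<bar>g' x\<bar>) has_integral M - g c) {c..b}"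
  proof (rule has_integral_spike[of "{c}"])
    show "(g' has_integral M - g c) {c..b}"
      using ftc[of c b] c ends by simp
  qed (use right in force)+
  ultimately have "((\<lambda>x. \<bar>g' x\<bar>) has_integral (M - g c) + (M - g c)) {a..b}"
    using c by (intro has_integral_combine[of a c b]) auto
  with c that show thesis by (simp add: algebra_simps)
qed

text \<open>Half the gradient of the squared distance to \<open>K\<close>; its norm is the
  distance.\<close>

definition offset :: "'a::euclidean_space set \<Rightarrow> 'a \<Rightarrow> 'a" where
  "offset K x = x - closest_point K x"

context
  fixes K :: "'a::euclidean_space set"
  assumes K: "compact_convex K" and ne: "K \<noteq> {}"
begin

lemma closed_convex: "closed K" "convex K"
  using K compact_convexD compact_imp_closed by blast+

lemma closest_point_mem: "closest_point K x \<in> K"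
  by (rule closest_point_in_set[OF closed_convex(1) ne])

lemma norm_offset_le: "y \<in> K \<Longrightarrow> norm (offset K x) \<le> norm (x - y)"
  using closest_point_le[OF closed_convex(1), of y x] by (simp add: offset_def dist_norm)

lemma offset_eq_0: "x \<in> K \<Longrightarrow> offset K x = 0"
  using norm_offset_le[of x x] by simp

lemma norm_closest_point_diff: "norm (closest_point K x - closest_point K y) \<le> norm (x - y)"
  using closest_point_lipschitz[OF closed_convex(2,1) ne, of x y] by (simp add: dist_norm)

lemma norm_offset_diff: "norm (offset K x - offset K y) \<le> 2 * norm (x - y)"
proof -
  have "offset K x - offset K y = (x - y) - (closest_point K x - closest_point K y)"
    by (simp add: offset_def)
  then have "norm (offset K x - offset K y) \<le> norm (x - y) + norm (closest_point K x - closest_point K y)"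
    by (metis norm_triangle_ineq4)
  then show ?thesis using norm_closest_point_diff[of x y] by simp
qed

lemma continuous_on_offset: "continuous_on S (offset K)"
  unfolding offset_def
  by (intro continuous_intros continuous_on_closest_point[OF closed_convex(2,1) ne])

text \<open>The closest-point map is 1-Lipschitz, so subtracting it from the identity leaves a
  monotone map. In other words, the squared distance is convex.\<close>

lemma offset_monotone: "0 \<le> (offset K x - offset K y) \<bullet> (x - y)"
proof -
  have "(closest_point K x - closest_point K y) \<bullet> (x - y) \<le> norm (x - y) * norm (x - y)"
    using norm_cauchy_schwarz[of "closest_point K x - closest_point K y" "x - y"]
      mult_right_mono[OF norm_closest_point_diff[of x y] norm_ge_zero[of "x - y"]] by linarith
  moreover have "(offset K x - offset K y) \<bullet> (x - y)
      = norm (x - y) * norm (x - y) - (closest_point K x - closest_point K y) \<bullet> (x - y)"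
  proof -
    have "offset K x - offset K y = (x - y) - (closest_point K x - closest_point K y)"
      by (simp add: offset_def)
    then show ?thesis by (simp only: inner_diff_left[of "x - y"] dot_square_norm power2_eq_square)
  qed
  ultimately show ?thesis by simp
qed

text \<open>The point closest to \<open>x\<close> competes in the minimization that defines the
  distance from \<open>y\<close>.\<close>

lemma norm_offset_sq_upper:
  "(norm (offset K y))\<^sup>2 \<le> (norm (offset K x))\<^sup>2 + 2 * (offset K x \<bullet> (y - x)) + (norm (y - x))\<^sup>2"
proof -
  have "(norm (offset K y))\<^sup>2 \<le> (norm (y - closest_point K x))\<^sup>2"
    using norm_offset_le[OF closest_point_mem] by (intro power_mono) auto
  also have "y - closest_point K x = offset K x + (y - x)" by (simp add: offset_def)
  also have "(norm (offset K x + (y - x)))\<^sup>2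
      = (norm (offset K x))\<^sup>2 + 2 * (offset K x \<bullet> (y - x)) + (norm (y - x))\<^sup>2"
    by (simp add: power2_norm_eq_inner inner_add_left inner_add_right inner_commute)
  finally show ?thesis .
qed

text \<open>Exchanging the points in the upper bound gives a lower bound with the gradient taken at
  \<open>y\<close>; the Lipschitz constant 2 of \<open>offset K\<close> moves it to
  \<open>x\<close>, whence \<open>5 = 2 * 2 + 1\<close>.\<close>

lemma norm_offset_sq_expansion:
  "\<bar>(norm (offset K y))\<^sup>2 - (norm (offset K x))\<^sup>2 - 2 * (offset K x \<bullet> (y - x))\<bar> \<le> 5 * (norm (y - x))\<^sup>2"
proof -
  have "\<bar>(offset K y - offset K x) \<bullet> (y - x)\<bar> \<le> norm (offset K y - offset K x) * norm (y - x)"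
    by (rule Cauchy_Schwarz_ineq2)
  also have "\<dots> \<le> (2 * norm (y - x)) * norm (y - x)"
    by (intro mult_right_mono norm_offset_diff) auto
  finally have 1: "\<bar>offset K y \<bullet> (y - x) - offset K x \<bullet> (y - x)\<bar> \<le> 2 * (norm (y - x))\<^sup>2"
    by (simp add: power2_eq_square inner_diff_left)
  have "offset K y \<bullet> (x - y) = - (offset K y \<bullet> (y - x))" by (simp add: inner_diff_right)
  with 1 norm_offset_sq_upper[of y x] norm_offset_sq_upper[of x y] zero_le_power2[of "norm (y - x)"]
  show ?thesis by (simp add: norm_minus_commute abs_le_iff)
qed

lemma has_derivative_norm_offset_sq:
  assumes \<xi>: "norm \<xi> = 1"
  shows "((\<lambda>\<tau>. (norm (offset K (y + \<tau> *\<^sub>R \<xi>)))\<^sup>2) has_real_derivative 2 * (offset K (y + \<tau> *\<^sub>R \<xi>) \<bullet> \<xi>)) (at \<tau>)"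
proof -
  define g where "g \<tau> = (norm (offset K (y + \<tau> *\<^sub>R \<xi>)))\<^sup>2" for \<tau>
  define d where "d = 2 * (offset K (y + \<tau> *\<^sub>R \<xi>) \<bullet> \<xi>)"
  have "\<bar>(g (\<tau> + h) - g \<tau>) / h - d\<bar> \<le> 5 * \<bar>h\<bar>" if "h \<noteq> 0" for h
  proof -
    have "\<bar>g (\<tau> + h) - g \<tau> - h * d\<bar> \<le> (5 * \<bar>h\<bar>) * \<bar>h\<bar>"
      using norm_offset_sq_expansion[of "y + (\<tau> + h) *\<^sub>R \<xi>" "y + \<tau> *\<^sub>R \<xi>"] \<xi>
      by (simp add: g_def d_def scaleR_left_diff_distrib[symmetric] mult.left_commute power2_eq_square)
    then have "\<bar>g (\<tau> + h) - g \<tau> - h * d\<bar> / \<bar>h\<bar> \<le> 5 * \<bar>h\<bar>"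
      using that by (subst pos_divide_le_eq) auto
    moreover have "(g (\<tau> + h) - g \<tau>) / h - d = (g (\<tau> + h) - g \<tau> - h * d) / h"
      using that by (simp add: field_simps)
    ultimately show ?thesis by simp
  qed
  then have "\<forall>\<^sub>F h in at 0. norm ((g (\<tau> + h) - g \<tau>) / h - d) \<le> 5 * \<bar>h\<bar>"
    unfolding eventually_at_filter real_norm_def by (intro always_eventually allI impI)
  moreover have "((\<lambda>h::real. 5 * \<bar>h\<bar>) \<longlongrightarrow> 0) (at 0)" by (auto intro!: tendsto_eq_intros)
  ultimately have "((\<lambda>h. (g (\<tau> + h) - g \<tau>) / h - d) \<longlongrightarrow> 0) (at 0)"
    by (rule Lim_null_comparison)
  then have "((\<lambda>h. (g (\<tau> + h) - g \<tau>) / h) \<longlongrightarrow> d) (at 0)"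
    by (rule LIM_zero_cancel)
  then have "(g has_real_derivative d) (at \<tau>)" by (rule DERIV_def[THEN iffD2])
  then show ?thesis by (simp only: g_def[abs_def] d_def)
qed

lemma parallel_body_eq:
  assumes "0 \<le> \<epsilon>"
  shows "{x. norm (offset K x) \<le> \<epsilon>} = K + cball 0 \<epsilon>"
proof (intro subset_antisym subsetI)
  fix x assume "x \<in> {x. norm (offset K x) \<le> \<epsilon>}"
  then have "closest_point K x + offset K x \<in> K + cball 0 \<epsilon>"
    using closest_point_mem by (intro set_plus_intro) auto
  then show "x \<in> K + cball 0 \<epsilon>" by (simp add: offset_def)
next
  fix x assume "x \<in> K + cball 0 \<epsilon>"
  then obtain k b where x: "x = k + b" "k \<in> K" "norm b \<le> \<epsilon>" by (auto simp: set_plus_def)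
  then show "x \<in> {x. norm (offset K x) \<le> \<epsilon>}" using norm_offset_le[of k x] by simp
qed

text \<open>On the line the squared distance \<open>g\<close> is convex and equals
  \<open>\<epsilon>\<^sup>2\<close> at both ends of the section, so the integral is twice
  \<open>\<epsilon>\<^sup>2\<close> minus the minimum of \<open>g\<close>. That minimum is
  nonnegative, and 0 if the line meets \<open>K\<close>.\<close>

lemma parallel_body_line_integral:
  assumes \<xi>: "norm \<xi> = 1" and \<epsilon>: "0 < \<epsilon>" and y: "y \<in> perp \<xi>"
  shows "(\<integral>\<^sup>+\<tau>. ennreal \<bar>2 * (offset K (y + \<tau> *\<^sub>R \<xi>) \<bullet> \<xi>)\<bar> * indicator (K + cball 0 \<epsilon>) (y + \<tau> *\<^sub>R \<xi>) \<partial>lborel)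
      \<le> ennreal (2 * \<epsilon>\<^sup>2) * indicator (perp_proj \<xi> ` (K + cball 0 \<epsilon>)) y" (is "?I \<le> _")
    and "ennreal (2 * \<epsilon>\<^sup>2) * indicator (perp_proj \<xi> ` K) y
      \<le> (\<integral>\<^sup>+\<tau>. ennreal \<bar>2 * (offset K (y + \<tau> *\<^sub>R \<xi>) \<bullet> \<xi>)\<bar> * indicator (K + cball 0 \<epsilon>) (y + \<tau> *\<^sub>R \<xi>) \<partial>lborel)"
proof -
  let ?Ke = "K + cball 0 \<epsilon>"
  define g where "g \<tau> = (norm (offset K (y + \<tau> *\<^sub>R \<xi>)))\<^sup>2" for \<tau>
  define g' where "g' \<tau> = 2 * (offset K (y + \<tau> *\<^sub>R \<xi>) \<bullet> \<xi>)" for \<tau>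
  have Ke: "compact_convex ?Ke" using K by (intro compact_convex_plus) auto
  obtain a b where ab: "{\<tau>. y + \<tau> *\<^sub>R \<xi> \<in> ?Ke} = {a..b}"
    using compact_convex_line_section[OF Ke \<xi>] by metis
  have mem: "y + \<tau> *\<^sub>R \<xi> \<in> ?Ke \<longleftrightarrow> g \<tau> \<le> \<epsilon>\<^sup>2" for \<tau>
    using \<epsilon> parallel_body_eq[of \<epsilon>] unfolding g_def by (auto simp: set_eq_iff abs_le_square_iff[symmetric])
  have memab: "g \<tau> \<le> \<epsilon>\<^sup>2 \<longleftrightarrow> \<tau> \<in> {a..b}" for \<tau>
    using ab mem by (auto simp: set_eq_iff)
  have der: "(g has_real_derivative g' x) (at x)" for x
    unfolding g_def g'_def by (rule has_derivative_norm_offset_sq[OF \<xi>])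
  have I: "?I = (\<integral>\<^sup>+\<tau>. ennreal \<bar>g' \<tau>\<bar> * indicator {a..b} \<tau> \<partial>lborel)"
    unfolding g'_def ab[symmetric] by (intro nn_integral_cong) (auto simp: indicator_def)
  have Kab: "\<exists>\<tau>\<in>{a..b}. g \<tau> = 0" if yK: "y \<in> perp_proj \<xi> ` K"
  proof -
    obtain \<tau> where \<tau>: "y + \<tau> *\<^sub>R \<xi> \<in> K" using yK mem_perp_proj_image_iff[OF \<xi> y] by auto
    then have "g \<tau> = 0" by (simp add: g_def offset_eq_0)
    with memab[of \<tau>] show ?thesis by auto
  qed
  have "?I \<le> ennreal (2 * \<epsilon>\<^sup>2) * indicator (perp_proj \<xi> ` ?Ke) y
    \<and> ennreal (2 * \<epsilon>\<^sup>2) * indicator (perp_proj \<xi> ` K) y \<le> ?I"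
  proof (cases "a \<le> b")
    case False
    then have "?I = 0" unfolding I by simp
    moreover have "y \<notin> perp_proj \<xi> ` K" using Kab False by force
    ultimately show ?thesis by simp
  next
    case True
    have cont: "isCont g x" for x using der DERIV_isCont by blast
    \<comment> \<open>At the end points \<open>g\<close> is at most
      \<open>\<epsilon>\<^sup>2\<close>, outside it is larger; continuity forces equality.\<close>
    have ends: "g a = \<epsilon>\<^sup>2" "g b = \<epsilon>\<^sup>2"
    proof -
      have "(g \<longlongrightarrow> g a) (at_left a)" "(g \<longlongrightarrow> g b) (at_right b)"
        using cont[of a] cont[of b] by (auto simp: isCont_def intro: filterlim_at_split[THEN iffD1, THEN conjunct1] filterlim_at_split[THEN iffD1, THEN conjunct2])
      moreover have "\<epsilon>\<^sup>2 \<le> g \<tau>" if "\<tau> < a \<or> b < \<tau>" for \<tau> using memab[of \<tau>] that by force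
      then have "\<forall>\<^sub>F \<tau> in at_left a. \<epsilon>\<^sup>2 \<le> g \<tau>" "\<forall>\<^sub>F \<tau> in at_right b. \<epsilon>\<^sup>2 \<le> g \<tau>"
        by (auto simp: eventually_at_filter)
      ultimately have "\<epsilon>\<^sup>2 \<le> g a" "\<epsilon>\<^sup>2 \<le> g b"
        by (auto intro: tendsto_lowerbound)
      with memab[of a] memab[of b] True show "g a = \<epsilon>\<^sup>2" "g b = \<epsilon>\<^sup>2" by auto
    qed
    have mono: "mono g'"
    proof (rule monoI)
      fix s t :: real assume st: "s \<le> t"
      show "g' s \<le> g' t"
      proof (cases "s = t")
        case False
        have "0 \<le> (t - s) * ((offset K (y + t *\<^sub>R \<xi>) - offset K (y + s *\<^sub>R \<xi>)) \<bullet> \<xi>)"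
          using offset_monotone[of "y + t *\<^sub>R \<xi>" "y + s *\<^sub>R \<xi>"]
          by (simp add: scaleR_left_diff_distrib[symmetric])
        then show ?thesis using False st by (simp add: g'_def inner_diff_left zero_le_mult_iff)
      qed simp
    qed
    obtain c where c: "c \<in> {a..b}" "\<And>x. x \<in> {a..b} \<Longrightarrow> g c \<le> g x"
      and hi: "((\<lambda>x. \<bar>g' x\<bar>) has_integral 2 * (\<epsilon>\<^sup>2 - g c)) {a..b}"
      by (rule has_integral_abs_deriv_valley[OF True der mono ends]) (rule that)
    have "?I = ennreal (2 * (\<epsilon>\<^sup>2 - g c))"
      unfolding I by (rule nn_integral_has_integral_lebesgue'[OF _ hi]) simp
    moreover have "0 \<le> g c" by (simp add: g_def)
    moreover have "y \<in> perp_proj \<xi> ` ?Ke"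
      unfolding mem_perp_proj_image_iff[OF \<xi> y] using memab[of a] mem[of a] True by auto
    moreover have "g c = 0" if "y \<in> perp_proj \<xi> ` K"
      using Kab[OF that] c(2) \<open>0 \<le> g c\<close> by (metis order_antisym)
    ultimately show ?thesis
      by (cases "y \<in> perp_proj \<xi> ` K") (auto intro: ennreal_leI)
  qed
  then show "?I \<le> ennreal (2 * \<epsilon>\<^sup>2) * indicator (perp_proj \<xi> ` ?Ke) y"
    "ennreal (2 * \<epsilon>\<^sup>2) * indicator (perp_proj \<xi> ` K) y \<le> ?I" by auto
qed

lemma parallel_body_offset_integral:
  assumes \<xi>: "norm \<xi> = 1" and \<epsilon>: "0 < \<epsilon>"
  defines "J \<equiv> LINT x:K + cball 0 \<epsilon>|lborel. \<bar>2 * (offset K x \<bullet> \<xi>)\<bar>"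
  shows "J \<le> 2 * \<epsilon>\<^sup>2 * shadow \<xi> (K + cball 0 \<epsilon>)" "2 * \<epsilon>\<^sup>2 * shadow \<xi> K \<le> J"
proof -
  let ?Ke = "K + cball 0 \<epsilon>" and ?L = "subspace_lborel (perp \<xi>)"
  let ?f = "\<lambda>x. \<bar>2 * (offset K x \<bullet> \<xi>)\<bar>"
  have Ke: "compact_convex ?Ke" using K by (intro compact_convex_plus) auto
  have PK: "compact_convex (perp_proj \<xi> ` K)" and PKe: "compact_convex (perp_proj \<xi> ` ?Ke)"
    using K Ke by (auto intro: compact_convex_linear_image linear_perp_proj)
  note [measurable] = compact_convex_borel[OF Ke] compact_convex_borel[OF PK] compact_convex_borel[OF PKe]
  have om [measurable]: "offset K \<in> borel_measurable borel"
    by (intro borel_measurable_continuous_onI continuous_on_offset)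
  have int: "set_integrable lborel ?Ke ?f"
    unfolding set_integrable_def
    by (intro borel_integrable_compact compact_convexD(1)[OF Ke] continuous_intros continuous_on_offset)
  have J: "ennreal J = (\<integral>\<^sup>+x. ennreal (?f x) * indicator ?Ke x \<partial>lborel)"
  proof -
    have "ennreal J = (\<integral>\<^sup>+x. ennreal (indicator ?Ke x *\<^sub>R ?f x) \<partial>lborel)"
      using int unfolding J_def set_lebesgue_integral_def set_integrable_def
      by (intro nn_integral_eq_integral[symmetric]) auto
    also have "\<dots> = (\<integral>\<^sup>+x. ennreal (?f x) * indicator ?Ke x \<partial>lborel)"
      by (intro nn_integral_cong) (auto simp: indicator_def)
    finally show ?thesis .
  qed
  have J': "ennreal J = (\<integral>\<^sup>+y. (\<integral>\<^sup>+\<tau>. ennreal (?f (y + \<tau> *\<^sub>R \<xi>)) * indicator ?Ke (y + \<tau> *\<^sub>R \<xi>) \<partial>lborel) \<partial>?L)"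
    unfolding J by (rule nn_integral_lborel_perp[OF \<xi>]) measurable
  have J0: "0 \<le> J" unfolding J_def set_lebesgue_integral_def by (intro integral_nonneg_AE) auto
  have perp: "AE y in ?L. y \<in> perp \<xi>" by (rule AE_subspace_lborel[OF subspace_perp])
  have "ennreal J \<le> (\<integral>\<^sup>+y. ennreal (2 * \<epsilon>\<^sup>2) * indicator (perp_proj \<xi> ` ?Ke) y \<partial>?L)"
    unfolding J' using perp
    by (intro nn_integral_mono_AE) (auto elim!: eventually_mono intro!: parallel_body_line_integral(1)[OF \<xi> \<epsilon>])
  also have "\<dots> = ennreal (2 * \<epsilon>\<^sup>2 * shadow \<xi> ?Ke)"
    by (simp add: nn_integral_cmult_indicator emeasure_shadow[OF Ke \<xi>] ennreal_mult'[symmetric])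
  finally show "J \<le> 2 * \<epsilon>\<^sup>2 * shadow \<xi> ?Ke"
    by (simp add: shadow_nonneg)
  have "ennreal (2 * \<epsilon>\<^sup>2 * shadow \<xi> K) = (\<integral>\<^sup>+y. ennreal (2 * \<epsilon>\<^sup>2) * indicator (perp_proj \<xi> ` K) y \<partial>?L)"
    by (simp add: nn_integral_cmult_indicator emeasure_shadow[OF K \<xi>] ennreal_mult'[symmetric])
  also have "\<dots> \<le> ennreal J"
    unfolding J' using perp
    by (intro nn_integral_mono_AE) (auto elim!: eventually_mono intro!: parallel_body_line_integral(2)[OF \<xi> \<epsilon>])
  finally show "2 * \<epsilon>\<^sup>2 * shadow \<xi> K \<le> J" using J0 by simp
qed

end

subsection \<open>Projection bodies are zonoids\<close>

text \<open>A Riemann sum over Borel pieces on which \<open>F\<close> is nearly constant; as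
  \<open>\<xi>\<close> is a unit vector, one choice of \<open>vs\<close> serves all
  directions.\<close>

lemma LINT_abs_inner_approx:
  fixes F :: "'a::euclidean_space \<Rightarrow> 'a"
  assumes F: "continuous_on UNIV F" and X: "compact X" and \<delta>: "0 < \<delta>"
  obtains vs where "\<And>\<xi>. norm \<xi> = 1 \<Longrightarrow>
    \<bar>(LINT x:X|lborel. \<bar>F x \<bullet> \<xi>\<bar>) - (\<Sum>v\<leftarrow>vs. \<bar>v \<bullet> \<xi>\<bar>)\<bar> \<le> \<delta> * vol X"
proof -
  define U where "U p = {x. norm (F x - F p) < \<delta>}" for p
  have U: "open (U p)" for p unfolding U_def
    by (intro open_Collect_less continuous_intros F continuous_on_subset[OF F]) auto
  have pU: "p \<in> U p" for p using \<delta> by (simp add: U_def)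
  have Xb: "X \<in> sets borel" using X by (rule borel_compact)
  have Xf: "emeasure lborel X < \<infinity>" by (intro emeasure_bounded_finite compact_imp_bounded X)
  have int: "set_integrable lborel Y (\<lambda>x. \<bar>F x \<bullet> \<xi>\<bar>)" if "Y \<in> sets borel" "Y \<subseteq> X" for Y \<xi>
  proof (rule set_integrable_subset)
    show "set_integrable lborel X (\<lambda>x. \<bar>F x \<bullet> \<xi>\<bar>)" unfolding set_integrable_def
      by (intro borel_integrable_compact X continuous_intros continuous_on_subset[OF F]) auto
  qed (use that in auto)
  have fin: "emeasure lborel Y < \<infinity>" if "Y \<subseteq> X" for Y
    using emeasure_mono[OF that, of lborel] Xf Xb by (simp add: le_less_trans)
  have const: "set_integrable lborel Y (\<lambda>x. c)" "(LINT x:Y|lborel. c) = c * vol Y"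
    if "Y \<in> sets borel" "Y \<subseteq> X" for Y and c :: real
    using that fin[OF that(2)] by (auto simp: set_integrable_def set_lebesgue_integral_def)
  \<comment> \<open>Peeling one set off the cover leaves some other Borel set, so the induction over
    \<open>T\<close> is for all \<open>Y\<close>.\<close>
  have step: "\<exists>vs. \<forall>\<xi>. norm \<xi> = 1 \<longrightarrow>
      \<bar>(LINT x:Y|lborel. \<bar>F x \<bullet> \<xi>\<bar>) - (\<Sum>v\<leftarrow>vs. \<bar>v \<bullet> \<xi>\<bar>)\<bar> \<le> \<delta> * vol Y"
    if "finite T" "Y \<in> sets borel" "Y \<subseteq> X" "Y \<subseteq> (\<Union>p\<in>T. U p)" for T Y
    using that
  proof (induction T arbitrary: Y rule: finite_induct)
    case empty
    then have "Y = {}" by auto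
    then show ?case by (intro exI[of _ "[]"]) (auto simp: set_lebesgue_integral_def)
  next
    case (insert p T)
    let ?Y1 = "Y \<inter> U p" and ?Y2 = "Y - U p"
    have Y1: "?Y1 \<in> sets borel" "?Y1 \<subseteq> X" and Y2: "?Y2 \<in> sets borel" "?Y2 \<subseteq> X" "?Y2 \<subseteq> (\<Union>p\<in>T. U p)"
      using insert.prems U[of p] by auto
    obtain vs where vs: "\<And>\<xi>. norm \<xi> = 1 \<Longrightarrow>
        \<bar>(LINT x:?Y2|lborel. \<bar>F x \<bullet> \<xi>\<bar>) - (\<Sum>v\<leftarrow>vs. \<bar>v \<bullet> \<xi>\<bar>)\<bar> \<le> \<delta> * vol ?Y2"
      using insert.IH[OF Y2] by blast
    have vol: "vol Y = vol ?Y1 + vol ?Y2"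
      using measure_Union[of lborel ?Y1 ?Y2] fin[OF Y1(2)] fin[OF Y2(2)] Y1(1) Y2(1)
      by (simp add: Int_Diff_Un Int_Diff disjoint_iff less_top[symmetric])
    show ?case
    \<comment> \<open>The piece contributes the value of \<open>F\<close> at \<open>p\<close>,
      weighted by the volume of the piece.\<close>
    proof (intro exI[of _ "(vol ?Y1 *\<^sub>R F p) # vs"] allI impI)
      fix \<xi> :: 'a assume \<xi>: "norm \<xi> = 1"
      let ?f = "\<lambda>x. \<bar>F x \<bullet> \<xi>\<bar>"
      have "\<bar>?f x - ?f p\<bar> \<le> \<delta>" if "x \<in> ?Y1" for x
      proof -
        have "\<bar>?f x - ?f p\<bar> \<le> \<bar>(F x - F p) \<bullet> \<xi>\<bar>" by (simp add: inner_diff_left)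
        also have "\<dots> \<le> norm (F x - F p)" using Cauchy_Schwarz_ineq2[of "F x - F p" \<xi>] \<xi> by simp
        finally show ?thesis using that by (simp add: U_def)
      qed
      then have near: "?f p - \<delta> \<le> ?f x" "?f x \<le> ?f p + \<delta>" if "x \<in> ?Y1" for x
        using that by (force simp: abs_le_iff)+
      have "(?f p - \<delta>) * vol ?Y1 \<le> (LINT x:?Y1|lborel. ?f x)" "(LINT x:?Y1|lborel. ?f x) \<le> (?f p + \<delta>) * vol ?Y1"
        unfolding const(2)[OF Y1, symmetric] using near
        by (intro set_integral_mono const(1)[OF Y1] int[OF Y1]; simp)+
      then have 1: "\<bar>(LINT x:?Y1|lborel. ?f x) - \<bar>(vol ?Y1 *\<^sub>R F p) \<bullet> \<xi>\<bar>\<bar> \<le> \<delta> * vol ?Y1"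
        by (simp add: abs_mult abs_le_iff algebra_simps)
      have "(LINT x:?Y1 \<union> ?Y2|lborel. ?f x) = (LINT x:?Y1|lborel. ?f x) + (LINT x:?Y2|lborel. ?f x)"
        by (intro set_integral_Un int) (use Y1 Y2 in auto)
      moreover have "?Y1 \<union> ?Y2 = Y" by auto
      ultimately have "(LINT x:Y|lborel. ?f x) = (LINT x:?Y1|lborel. ?f x) + (LINT x:?Y2|lborel. ?f x)"
        by simp
      with 1 vs[OF \<xi>] show "\<bar>(LINT x:Y|lborel. ?f x) - (\<Sum>v\<leftarrow>(vol ?Y1 *\<^sub>R F p) # vs. \<bar>v \<bullet> \<xi>\<bar>)\<bar> \<le> \<delta> * vol Y"
        unfolding vol by (simp add: distrib_left)
    qed
  qed
  obtain T where "finite T" "X \<subseteq> (\<Union>p\<in>T. U p)"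
    using compactE_image[OF X, of X U] U pU by (metis UN_I subsetI)
  from step[OF this(1) Xb subset_refl this(2)] that show thesis by blast
qed

section \<open>Comparing convex sets through support functions\<close>

lemma scaleR_mem_seg: "\<bar>t\<bar> \<le> 1 \<Longrightarrow> t *\<^sub>R v \<in> seg v"
  by (auto simp: seg_def abs_le_iff)

text \<open>The coefficient of \<open>v\<close> is the sign of \<open>v \<bullet> u\<close>. With
  \<open>zonotope_inner_bound\<close> this identifies the sum as the support function of the
  zonotope.\<close>

lemma zonotope_support_attained:
  obtains x where "x \<in> zonotope vs" "u \<bullet> x = (\<Sum>v\<leftarrow>vs. \<bar>v \<bullet> u\<bar>)"
proof -
  have "\<exists>x\<in>zonotope vs. u \<bullet> x = (\<Sum>v\<leftarrow>vs. \<bar>v \<bullet> u\<bar>)"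
  proof (induction vs)
    case (Cons v vs)
    then obtain x where x: "x \<in> zonotope vs" "u \<bullet> x = (\<Sum>v\<leftarrow>vs. \<bar>v \<bullet> u\<bar>)" by auto
    have "sgn (v \<bullet> u) *\<^sub>R v + x \<in> zonotope (v # vs)"
      unfolding zonotope_Cons by (intro set_plus_intro scaleR_mem_seg x(1)) (simp add: abs_sgn_eq)
    moreover have "u \<bullet> (sgn (v \<bullet> u) *\<^sub>R v + x) = (\<Sum>v\<leftarrow>v # vs. \<bar>v \<bullet> u\<bar>)"
      using x(2) by (simp add: inner_add_right inner_commute[of u v] linordered_idom_class.abs_sgn mult.commute)
    ultimately show ?case by blast
  qed simp
  with that show thesis by blast
qed

text \<open>A point of \<open>E\<close> outside \<open>W\<close> would be strictly separated from
  \<open>W\<close>. Each \<open>x\<close> gets its own witness, which avoids suprema.\<close>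

lemma subset_if_support_le:
  fixes W :: "'a::euclidean_space set"
  assumes W: "closed W" "convex W"
    and le: "\<And>u x. norm u = 1 \<Longrightarrow> x \<in> E \<Longrightarrow> \<exists>w\<in>W. u \<bullet> x \<le> u \<bullet> w"
  shows "E \<subseteq> W"
proof
  fix x assume x: "x \<in> E"
  show "x \<in> W"
  proof (rule ccontr)
    assume "x \<notin> W"
    then obtain a b where ab: "a \<bullet> x < b" "\<And>w. w \<in> W \<Longrightarrow> b < a \<bullet> w"
      using separating_hyperplane_closed_point[OF W(2,1)] by blast
    show False
    proof (cases "a = 0")
      \<comment> \<open>A vanishing normal is contradictory only if \<open>W\<close> has a point;
        the hypothesis for any unit vector supplies one.\<close>
      case True
      obtain w where "w \<in> W" using le[OF _ x, of "SOME i. i \<in> Basis"] by (metis norm_Basis some_in_eq nonempty_Basis)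
      with ab[of] True show False by force
    next
      case False
      then have "norm (- sgn a) = 1" by (simp add: norm_sgn)
      then obtain w where w: "w \<in> W" "- sgn a \<bullet> x \<le> - sgn a \<bullet> w" using le[OF _ x] by blast
      have "inverse (norm a) * (a \<bullet> w) \<le> inverse (norm a) * (a \<bullet> x)"
        using w(2) by (simp add: sgn_div_norm)
      then have "a \<bullet> w \<le> a \<bullet> x" using False by simp
      with ab w(1) show False by force
    qed
  qed
qed

lemma vol_translation:
  assumes A: "A \<in> sets borel"
  shows "vol ({c} + A) = vol A"
proof -
  have "x \<in> {c} + A \<longleftrightarrow> - c + x \<in> A" for x
  proof
    assume "- c + x \<in> A"
    then have "c + (- c + x) \<in> {c} + A" by (intro set_plus_intro insertI1)
    then show "x \<in> {c} + A" by simp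
  next
    assume "x \<in> {c} + A"
    then obtain y where "y \<in> A" "x = c + y" by (auto simp: set_plus_def)
    then show "- c + x \<in> A" by simp
  qed
  then have eq: "{c} + A = (+) (- c) -` A" by (simp add: set_eq_iff)
  have "emeasure lborel A = emeasure (distr lborel borel ((+) (- c))) A"
    by (simp add: lborel_distr_plus)
  also have "\<dots> = emeasure lborel ({c} + A)" unfolding eq using A by (subst emeasure_distr) auto
  finally show ?thesis by (simp add: measure_def)
qed

lemma shadow_translation:
  assumes A: "compact_convex A" and \<xi>: "norm \<xi> = 1"
  shows "shadow \<xi> ({c} + A) = shadow \<xi> A"
proof -
  have "vol ({c} + A + seg (1 *\<^sub>R \<xi>)) = vol (A + seg (1 *\<^sub>R \<xi>))"
    unfolding add.assoc using A by (intro vol_translation compact_convex_borel compact_convex_plus) auto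
  moreover have "vol ({c} + A) = vol A"
    using A by (intro vol_translation compact_convex_borel)
  ultimately show ?thesis
    using vol_plus_seg[OF A \<xi>, of 1] vol_plus_seg[OF compact_convex_plus[OF compact_convex_singleton A] \<xi>, of 1 c]
    by simp
qed

text \<open>With \<open>c\<close> moved to the origin, the ball of radius \<open>\<epsilon>\<close>
  lies in the dilate of the body by \<open>\<epsilon> / \<rho>\<close>, so the parallel body lies in
  a translated dilate by \<open>1 + \<epsilon> / \<rho>\<close>.\<close>

lemma shadow_parallel_body_le:
  fixes K :: "'a::euclidean_space set"
  assumes K: "compact_convex K" and c: "cball c \<rho> \<subseteq> K" "0 < \<rho>" and \<xi>: "norm \<xi> = 1" and \<epsilon>: "0 < \<epsilon>"
  shows "shadow \<xi> (K + cball 0 \<epsilon>) \<le> (1 + \<epsilon> / \<rho>) ^ (DIM('a) - 1) * shadow \<xi> K"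
proof -
  define K' where "K' = {-c} + K"
  have K': "compact_convex K'" unfolding K'_def using K by (intro compact_convex_plus) auto
  have KK': "K = {c} + K'" unfolding K'_def add.assoc[symmetric] by (simp add: set_plus_def)
  have "cball 0 \<epsilon> \<subseteq> (*\<^sub>R) (\<epsilon> / \<rho>) ` K'"
  proof
    fix x :: 'a assume x: "x \<in> cball 0 \<epsilon>"
    have "norm ((\<rho> / \<epsilon>) *\<^sub>R x) \<le> \<rho>"
      using x \<epsilon> c(2) by (simp add: field_simps)
    then have "c + (\<rho> / \<epsilon>) *\<^sub>R x \<in> K" using c by (auto simp: subset_iff dist_norm)
    then have "-c + (c + (\<rho> / \<epsilon>) *\<^sub>R x) \<in> K'" unfolding K'_def by (intro set_plus_intro) auto
    then show "x \<in> (*\<^sub>R) (\<epsilon> / \<rho>) ` K'" using \<epsilon> c(2)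
      by (intro image_eqI[of _ _ "(\<rho> / \<epsilon>) *\<^sub>R x"]) auto
  qed
  then have "K + cball 0 \<epsilon> \<subseteq> {c} + ((*\<^sub>R) 1 ` K' + (*\<^sub>R) (\<epsilon> / \<rho>) ` K')"
    unfolding KK' add.assoc by (intro set_plus_mono2) auto
  also have "\<dots> = {c} + (*\<^sub>R) (1 + \<epsilon> / \<rho>) ` K'"
    using K' \<epsilon> c(2) by (subst scale_add_convex) (auto dest: compact_convexD)
  finally have "shadow \<xi> (K + cball 0 \<epsilon>) \<le> shadow \<xi> ({c} + (*\<^sub>R) (1 + \<epsilon> / \<rho>) ` K')"
    using K K' \<xi> by (intro shadow_mono compact_convex_plus compact_convex_scale) auto
  also have "\<dots> = (1 + \<epsilon> / \<rho>) ^ (DIM('a) - 1) * shadow \<xi> K'"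
    using K' \<xi> \<epsilon> c(2) by (simp add: shadow_translation compact_convex_scale shadow_scale add_pos_pos)
  also have "shadow \<xi> K' = shadow \<xi> K"
    unfolding K'_def using K \<xi> by (rule shadow_translation)
  finally show ?thesis .
qed

text \<open>
  For \<open>d\<close> the distance function of \<open>K\<close>, the integral of the absolute value of the directional
  derivative of \<open>d\<^sup>2\<close> over a thin parallel body is a mixture of absolute values of linear forms,
  hence nearly a finite sum of such; along every line meeting \<open>K\<close> the integral is constant,
  so it reproduces the measure of the projection.
\<close>
lemma zonoid_if_support_eq_shadow:
  fixes E K :: "'a::euclidean_space set"
  assumes E: "compact_convex E" and r: "0 < r" "cball 0 r \<subseteq> E"
    and K: "compact_convex K" and \<rho>: "cball c \<rho> \<subseteq> K" "0 < \<rho>"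
    and supp: "\<And>\<xi>. norm \<xi> = 1 \<Longrightarrow> support_function E \<xi> = shadow \<xi> K"
  shows "zonoid E"
  unfolding zonoid_def
proof (intro conjI allI impI)
  show "compact_convex E" by fact
  fix \<epsilon>0 :: real assume \<epsilon>0: "0 < \<epsilon>0"
  let ?h = "\<lambda>\<xi>. shadow \<xi> K"
  have bdd: "bdd_above ((\<bullet>) u ` E)" for u
    by (intro bounded_imp_bdd_above compact_imp_bounded compact_continuous_image compact_convexD(1)[OF E] continuous_intros)
  have Ene: "E \<noteq> {}" using r by auto
  have h_ge: "u \<bullet> x \<le> ?h u" if "norm u = 1" "x \<in> E" for u x
    unfolding supp[OF that(1), symmetric] support_function_def using that bdd by (intro cSUP_upper) auto
  have h_att: "\<exists>x\<in>E. u \<bullet> x = ?h u" if u: "norm u = 1" for u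
  proof -
    have "continuous_on E ((\<bullet>) u)" by (intro continuous_intros)
    then obtain x where x: "x \<in> E" "\<And>y. y \<in> E \<Longrightarrow> u \<bullet> y \<le> u \<bullet> x"
      using continuous_attains_sup[OF compact_convexD(1)[OF E] Ene] by metis
    then have "?h u \<le> u \<bullet> x"
      unfolding supp[OF u, symmetric] support_function_def by (intro cSUP_least Ene)
    with h_ge[OF u x(1)] x(1) show ?thesis by force
  qed
  have h_r: "r \<le> ?h u" if "norm u = 1" for u
    using h_ge[OF that, of "r *\<^sub>R u"] r that by (auto simp: subset_iff dot_square_norm)
  \<comment> \<open>The parallel body and the finite sum each cost a relative error
    \<open>k\<close>; it is chosen so that the upper and the lower bound, \<open>1 + 2 * k\<close>
    and \<open>1 - k\<close>, have ratio \<open>1 + \<epsilon>0\<close>.\<close>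
  define k where "k = \<epsilon>0 / (3 + \<epsilon>0)"
  have k: "0 < k" "k < 1" "1 + 2 * k = (1 + \<epsilon>0) * (1 - k)"
    using \<epsilon>0 by (auto simp: k_def field_simps)
  have "((\<lambda>\<epsilon>. (1 + \<epsilon> / \<rho>) ^ (DIM('a) - 1)) \<longlongrightarrow> 1) (at_right 0)"
    using \<rho> by (auto intro!: tendsto_eq_intros)
  then have "\<forall>\<^sub>F \<epsilon> in at_right 0. (1 + \<epsilon> / \<rho>) ^ (DIM('a) - 1) < 1 + k"
    using k by (intro order_tendstoD(2)) auto
  with eventually_at_right_less[of "0::real"]
  have "\<forall>\<^sub>F \<epsilon> in at_right 0. 0 < \<epsilon> \<and> (1 + \<epsilon> / \<rho>) ^ (DIM('a) - 1) < 1 + k"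
    by eventually_elim auto
  then obtain \<epsilon> where \<epsilon>: "0 < \<epsilon>" "(1 + \<epsilon> / \<rho>) ^ (DIM('a) - 1) < 1 + k"
    using eventually_happens'[OF trivial_limit_at_right_real] by blast
  let ?X = "K + cball 0 \<epsilon>"
  define J where "J \<xi> = (LINT x:?X|lborel. \<bar>(2 *\<^sub>R offset K x) \<bullet> \<xi>\<bar>)" for \<xi>
  have Kne: "K \<noteq> {}" using \<rho> by auto
  have J: "2 * \<epsilon>\<^sup>2 * ?h \<xi> \<le> J \<xi>" "J \<xi> \<le> 2 * \<epsilon>\<^sup>2 * ((1 + k) * ?h \<xi>)" if \<xi>: "norm \<xi> = 1" for \<xi>
  proof -
    show "2 * \<epsilon>\<^sup>2 * ?h \<xi> \<le> J \<xi>"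
      using parallel_body_offset_integral(2)[OF K Kne \<xi> \<epsilon>(1)] by (simp add: J_def)
    have "J \<xi> \<le> 2 * \<epsilon>\<^sup>2 * shadow \<xi> ?X"
      using parallel_body_offset_integral(1)[OF K Kne \<xi> \<epsilon>(1)] by (simp add: J_def)
    also have "\<dots> \<le> 2 * \<epsilon>\<^sup>2 * ((1 + k) * ?h \<xi>)"
    proof (intro mult_left_mono)
      show "shadow \<xi> ?X \<le> (1 + k) * ?h \<xi>"
        using shadow_parallel_body_le[OF K \<rho> \<xi> \<epsilon>(1)] \<epsilon>(2)
          mult_right_mono[of "(1 + \<epsilon> / \<rho>) ^ (DIM('a) - 1)" "1 + k" "?h \<xi>"] shadow_nonneg[of \<xi> K] by linarith
    qed auto
    finally show "J \<xi> \<le> 2 * \<epsilon>\<^sup>2 * ((1 + k) * ?h \<xi>)" .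
  qed
  have X: "compact ?X" using K by (intro compact_convexD compact_convex_plus) auto
  \<comment> \<open>\<open>r\<close> bounds the support function from below and so turns the
    absolute error into a relative one; the 1 keeps the denominator positive.\<close>
  define \<delta> where "\<delta> = 2 * \<epsilon>\<^sup>2 * k * r / (1 + vol ?X)"
  have \<delta>: "0 < \<delta>" "\<delta> * vol ?X \<le> 2 * \<epsilon>\<^sup>2 * k * r"
    using \<epsilon> k r by (auto simp: \<delta>_def field_simps add_pos_nonneg intro!: divide_pos_pos add_pos_nonneg)
  have "continuous_on UNIV (\<lambda>x. 2 *\<^sub>R offset K x)"
    by (intro continuous_intros continuous_on_offset[OF K Kne])
  from LINT_abs_inner_approx[OF this X \<delta>(1)] obtain ws where ws0: "\<And>\<xi>. norm \<xi> = 1 \<Longrightarrow>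
      \<bar>(LINT x:?X|lborel. \<bar>(2 *\<^sub>R offset K x) \<bullet> \<xi>\<bar>) - (\<Sum>v\<leftarrow>ws. \<bar>v \<bullet> \<xi>\<bar>)\<bar> \<le> \<delta> * vol ?X"
    by blast
  then have ws: "\<bar>J \<xi> - (\<Sum>v\<leftarrow>ws. \<bar>v \<bullet> \<xi>\<bar>)\<bar> \<le> \<delta> * vol ?X" if "norm \<xi> = 1" for \<xi>
    using that unfolding J_def by blast
  \<comment> \<open>Normalized so that the lower bound becomes the support function of
    \<open>E\<close> itself.\<close>
  define s where "s = 2 * \<epsilon>\<^sup>2 * (1 - k)"
  have s: "0 < s" using \<epsilon> k by (simp add: s_def)
  define vs where "vs = map ((*\<^sub>R) (1 / s)) ws"
  define h' where "h' u = (\<Sum>v\<leftarrow>vs. \<bar>v \<bullet> u\<bar>)" for u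
  have h': "h' u = (\<Sum>v\<leftarrow>ws. \<bar>v \<bullet> u\<bar>) / s" for u
    using s by (simp add: h'_def vs_def o_def abs_mult sum_list_const_mult divide_inverse mult.commute flip: sum_list_mult_const)
  have bounds: "?h u \<le> h' u" "h' u \<le> (1 + \<epsilon>0) * ?h u" if u: "norm u = 1" for u
  proof -
    have "2 * \<epsilon>\<^sup>2 * k * r \<le> 2 * \<epsilon>\<^sup>2 * k * ?h u"
      using h_r[OF u] k by (intro mult_left_mono) auto
    then have d: "\<bar>J u - (\<Sum>v\<leftarrow>ws. \<bar>v \<bullet> u\<bar>)\<bar> \<le> 2 * \<epsilon>\<^sup>2 * (k * ?h u)"
      using ws[OF u] \<delta>(2) by (simp add: mult.assoc)
    have "s * ?h u \<le> (\<Sum>v\<leftarrow>ws. \<bar>v \<bullet> u\<bar>)"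
      using d J(1)[OF u] by (simp add: s_def algebra_simps abs_le_iff)
    then show "?h u \<le> h' u" unfolding h' using s by (simp add: field_simps)
    have "(\<Sum>v\<leftarrow>ws. \<bar>v \<bullet> u\<bar>) \<le> 2 * \<epsilon>\<^sup>2 * ((1 + 2 * k) * ?h u)"
      using d J(2)[OF u] by (simp add: algebra_simps abs_le_iff)
    also have "\<dots> = s * ((1 + \<epsilon>0) * ?h u)" unfolding k(3) s_def by simp
    finally show "h' u \<le> (1 + \<epsilon>0) * ?h u" unfolding h' using s by (simp add: field_simps)
  qed
  show "\<exists>vs. E \<subseteq> zonotope vs \<and> zonotope vs \<subseteq> (*\<^sub>R) (1 + \<epsilon>0) ` E"
  proof (intro exI conjI)
    note cW = compact_convexD[OF compact_convex_zonotope[of vs]]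
    show "E \<subseteq> zonotope vs"
    proof (rule subset_if_support_le[OF compact_imp_closed[OF cW(1)] cW(2)])
      fix u x :: 'a assume u: "norm u = 1" and x: "x \<in> E"
      obtain w where "w \<in> zonotope vs" "u \<bullet> w = h' u"
        unfolding h'_def by (rule zonotope_support_attained)
      with h_ge[OF u x] bounds(1)[OF u] show "\<exists>w\<in>zonotope vs. u \<bullet> x \<le> u \<bullet> w"
        by (intro bexI[of _ w]) auto
    qed
    note cE = compact_convexD[OF compact_convex_scale[OF E, of "1 + \<epsilon>0"]]
    show "zonotope vs \<subseteq> (*\<^sub>R) (1 + \<epsilon>0) ` E"
    proof (rule subset_if_support_le[OF compact_imp_closed[OF cE(1)] cE(2)])
      fix u x :: 'a assume u: "norm u = 1" and x: "x \<in> zonotope vs"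
      obtain e where e: "e \<in> E" "u \<bullet> e = ?h u" using h_att[OF u] by blast
      have "u \<bullet> x \<le> h' u"
        using zonotope_inner_bound[OF x, of u] by (simp add: h'_def inner_commute abs_le_iff)
      with bounds(2)[OF u] e show "\<exists>w\<in>(*\<^sub>R) (1 + \<epsilon>0) ` E. u \<bullet> x \<le> u \<bullet> w"
        by (intro bexI[of _ "(1 + \<epsilon>0) *\<^sub>R e"]) auto
    qed
  qed
qed

text \<open>By rotation invariance all shadows of the unit ball equal some \<open>c\<close>, so the
  ball of radius \<open>c\<close> is its projection body and the support criterion applies.\<close>

lemma zonoid_cball: "zonoid (cball (0 :: real ^ 'n) 1)"
proof -
  let ?B = "cball (0 :: real ^ 'n) 1"
  have "(axis undefined 1 :: real ^ 'n) \<in> Basis" by (simp add: axis_in_Basis_iff)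
  then obtain e :: "real ^ 'n" where e: "norm e = 1" by (meson norm_Basis)
  define c where "c = shadow e ?B"
  have const: "shadow \<xi> ?B = c" if \<xi>: "norm \<xi> = 1" for \<xi> :: "real ^ 'n"
  proof -
    obtain T where T: "orthogonal_transformation T" "T e = \<xi>"
      using orthogonal_transformation_exists_1[OF e \<xi>] .
    note lin = orthogonal_transformation_linear[OF T(1)]
    have "T ` (?B + seg (1 *\<^sub>R e)) = ?B + seg (1 *\<^sub>R \<xi>)"
      using image_orthogonal_transformation_cball[OF T(1), of 0 1]
      by (simp add: linear_image_plus[OF lin] linear_image_seg[OF lin] T(2) linear_0[OF lin])
    moreover have "vol (T ` A) = vol A" if A: "compact_convex A" for A
    proof -
      have "emeasure lborel (T ` A) = emeasure (distr lborel borel T) (T ` A)"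
        by (simp add: distr_lborel_orthogonal[OF T(1)])
      also have "\<dots> = emeasure lborel A"
        using compact_convex_linear_image[OF lin A] orthogonal_transformation_inj[OF T(1)] lin
        by (subst emeasure_distr)
          (auto intro: borel_measurable_linear simp: inj_vimage_image_eq compact_convex_borel)
      finally show ?thesis by (simp add: measure_def)
    qed
    ultimately have "vol (?B + seg (1 *\<^sub>R \<xi>)) = vol (?B + seg (1 *\<^sub>R e))"
      by (metis compact_convex_cball compact_convex_plus compact_convex_seg)
    then show ?thesis
      using vol_plus_seg[of ?B \<xi> 1] vol_plus_seg[of ?B e 1] e \<xi> by (simp add: c_def)
  qed
  \<comment> \<open>The ball lies in the cylinder of height 2 over its shadow, whose volume is
    \<open>2 * c\<close>.\<close>
  have c: "0 < c"
  proof -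
    have PB: "compact_convex (perp_proj e ` ?B)"
      by (intro compact_convex_linear_image linear_perp_proj compact_convex_cball)
    have "?B \<subseteq> perp_proj e ` ?B + seg (1 *\<^sub>R e)"
    proof
      fix x :: "real ^ 'n" assume x: "x \<in> ?B"
      have "\<bar>e \<bullet> x\<bar> \<le> 1" using Cauchy_Schwarz_ineq2[of e x] e x by simp
      then have "perp_proj e x + (e \<bullet> x) *\<^sub>R e \<in> perp_proj e ` ?B + seg (1 *\<^sub>R e)"
        using x by (intro set_plus_intro) (auto intro: scaleR_mem_seg)
      then show "x \<in> perp_proj e ` ?B + seg (1 *\<^sub>R e)" using perp_proj_decomp[OF e, of x] by simp
    qed
    then have "vol ?B \<le> vol (perp_proj e ` ?B + seg (1 *\<^sub>R e))"
      using PB by (intro vol_mono compact_convex_plus) auto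
    also have "\<dots> \<le> 2 * vol (perp_proj e ` ?B + seg ((1/2) *\<^sub>R e))"
      using vol_plus_seg[OF PB e, of 1] vol_plus_seg[OF PB e, of "1/2"] by simp
    also have "\<dots> = 2 * c" unfolding c_def by (subst shadow_eq_vol) (auto simp: e)
    finally show ?thesis using content_cball_pos[of 1 "0 :: real ^ 'n"] by linarith
  qed
  have "zonoid (cball (0 :: real ^ 'n) c)"
  proof (rule zonoid_if_support_eq_shadow[of _ c ?B 0 1])
    fix \<xi> :: "real ^ 'n" assume \<xi>: "norm \<xi> = 1"
    have "support_function (cball 0 c) \<xi> = c"
      unfolding support_function_def
    proof (rule cSup_eq_maximum)
      show "c \<in> (\<bullet>) \<xi> ` cball 0 c"
        using \<xi> c by (intro image_eqI[of _ _ "c *\<^sub>R \<xi>"]) (auto simp: dot_square_norm)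
      fix y assume "y \<in> (\<bullet>) \<xi> ` cball 0 c"
      then obtain x where "norm x \<le> c" "y = \<xi> \<bullet> x" by auto
      then show "y \<le> c" using norm_cauchy_schwarz[of \<xi> x] \<xi> by simp
    qed
    then show "support_function (cball 0 c) \<xi> = shadow \<xi> ?B" using const[OF \<xi>] by simp
  qed (use c in auto)
  from zonoid_scale[OF this, of "1 / c"] show ?thesis using c by (simp add: cball_scale)
qed

lemma projection_body_zonoid:
  fixes Z :: "'a::euclidean_space set"
  assumes "projection_body Z"
  shows "zonoid Z"
proof -
  obtain K where K: "convex_body K" and Z: "convex_body Z" "uminus ` Z = Z"
    and h: "\<And>\<xi>. norm \<xi> = 1 \<Longrightarrow> support_function Z \<xi> = shadow \<xi> K"
    using assms by (auto simp: projection_body_def projection_body_of_def shadow_def)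
  obtain c \<rho> where \<rho>: "cball c \<rho> \<subseteq> K" "0 < \<rho>"
    using K open_contains_cball[of "interior K"] interior_subset[of K]
    unfolding convex_body_def by (metis all_not_in_conv open_interior subset_trans)
  obtain d r where r: "cball d r \<subseteq> Z" "0 < r"
    using Z open_contains_cball[of "interior Z"] interior_subset[of Z]
    unfolding convex_body_def by (metis all_not_in_conv open_interior subset_trans)
  \<comment> \<open>A ball inside \<open>Z\<close> is averaged with its mirror image.\<close>
  have "cball 0 r \<subseteq> Z"
  proof
    fix x :: 'a assume x: "x \<in> cball 0 r"
    then have "d + x \<in> Z" "d - x \<in> Z" using r by (auto simp: subset_iff dist_norm)
    then have "x - d \<in> Z" using Z(2) by (metis image_eqI minus_diff_eq)
    with \<open>d + x \<in> Z\<close> have "(1 / 2) *\<^sub>R (d + x) + (1 / 2) *\<^sub>R (x - d) \<in> Z"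
      using Z(1) by (intro convexD) (auto simp: convex_body_def)
    also have "(1 / 2) *\<^sub>R (d + x) + (1 / 2) *\<^sub>R (x - d) = x"
      by (simp add: scaleR_add_right[symmetric] flip: scaleR_2)
    finally show "x \<in> Z" .
  qed
  then show ?thesis
    using K Z r \<rho> h
    by (intro zonoid_if_support_eq_shadow[of Z r K c \<rho>]) (auto simp: convex_body_def compact_convex_def)
qed

subsection \<open>Surface area of zonoids\<close>

text \<open>The limit over the approximating zonotopes is taken here; afterwards only
  \<open>Z\<close> occurs. The total length of the segments depends on the approximation and is
  replaced by the lower bound that the volume of \<open>Z\<close> imposes on it.\<close>

lemma vol_zonoid_plus_ball_ge:
  fixes Z :: "'a::euclidean_space set"
  assumes Z: "zonoid Z" and m: "0 \<le> m" and t: "0 < t" and s: "0 < s"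
    and sh: "\<And>\<xi>. norm \<xi> = 1 \<Longrightarrow> m * t \<le> shadow \<xi> (Z + (*\<^sub>R) t ` cball 0 1) - shadow \<xi> Z"
  defines "n \<equiv> DIM('a)"
  shows "vol (Z + (*\<^sub>R) t ` cball 0 1) + s * (n * vol Z + m * t * root n (fact n * vol Z))
    \<le> vol ((*\<^sub>R) (1 + s) ` Z + (*\<^sub>R) t ` cball 0 1)"
proof (rule le_of_tendsto_at_right')
  let ?B = "(*\<^sub>R) t ` cball (0::'a) 1"
  let ?F = "vol (Z + ?B)" and ?G = "vol ((*\<^sub>R) (1 + s) ` Z + ?B)" and ?R = "root n (fact n * vol Z)"
  have n: "0 < n" by (simp add: n_def)
  note cZ = zonoid_compact_convex[OF Z]
  have cB: "compact_convex ?B" by (intro compact_convex_scale compact_convex_cball)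
  have cZB: "compact_convex (Z + ?B)" by (intro compact_convex_plus cZ cB)
  have csZB: "compact_convex ((*\<^sub>R) (1 + s) ` Z + ?B)" by (intro compact_convex_plus compact_convex_scale cZ cB)
  show "((\<lambda>\<epsilon>. (1 + \<epsilon>) ^ (n - 1) * (?F + s * (m * t * ?R)) + s * (n * vol Z))
      \<longlongrightarrow> ?F + s * (n * vol Z + m * t * ?R)) (at_right 0)"
    by (auto intro!: tendsto_eq_intros simp: algebra_simps)
  show "((\<lambda>\<epsilon>. (1 + \<epsilon>) ^ (n - 1) * ((1 + \<epsilon>) ^ n * ?G)) \<longlongrightarrow> ?G) (at_right 0)"
    by (auto intro!: tendsto_eq_intros)
  fix \<epsilon> :: real assume \<epsilon>: "0 < \<epsilon>"
  then obtain vs where vs: "Z \<subseteq> zonotope vs" "zonotope vs \<subseteq> (*\<^sub>R) (1 + \<epsilon>) ` Z"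
    using Z unfolding zonoid_def by metis
  let ?W = "zonotope vs"
  have cW: "compact_convex ?W" by simp
  define M where "M = (\<Sum>v\<leftarrow>vs. norm v)"
  define \<Sigma> where "\<Sigma> = (\<Sum>v\<leftarrow>vs. 2 * norm v * shadow (sgn v) Z)"
  have mono: "2 * norm v * shadow (sgn v) A \<le> 2 * norm v * shadow (sgn v) A'"
    if "compact_convex A" "compact_convex A'" "A \<subseteq> A'" for A A' and v :: 'a
    using that shadow_mono[of A A' "sgn v"] by (cases "v = 0") (auto simp: norm_sgn intro!: mult_left_mono)
  have M: "?R \<le> 2 * M"
  proof -
    have M0: "0 \<le> M" unfolding M_def by (intro sum_list_nonneg) auto
    have "vol Z \<le> vol ?W" by (intro vol_mono cZ cW vs)
    also have "\<dots> \<le> (2 * M) ^ n / fact n" unfolding M_def n_def by (rule vol_zonotope_le)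
    finally have "fact n * vol Z \<le> (2 * M) ^ n" by (simp add: field_simps)
    then have "?R \<le> root n ((2 * M) ^ n)" by (subst real_root_le_iff[OF n])
    also have "\<dots> = 2 * M" using M0 n by (intro real_root_power_cancel) auto
    finally show ?thesis .
  qed
  have "n * vol Z \<le> n * vol ?W" using vs by (intro mult_left_mono vol_mono cZ cW) auto
  also have "\<dots> \<le> (\<Sum>v\<leftarrow>vs. 2 * norm v * shadow (sgn v) ?W)"
    unfolding n_def by (rule vol_zonotope_le_shadows)
  also have "\<dots> \<le> (\<Sum>v\<leftarrow>vs. 2 * norm v * shadow (sgn v) ((*\<^sub>R) (1 + \<epsilon>) ` Z))"
    using vs by (intro sum_list_mono mono compact_convex_scale cZ cW) auto
  also have "\<dots> = (1 + \<epsilon>) ^ (n - 1) * \<Sigma>"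
  proof -
    have "2 * norm v * shadow (sgn v) ((*\<^sub>R) (1 + \<epsilon>) ` Z)
        = (1 + \<epsilon>) ^ (n - 1) * (2 * norm v * shadow (sgn v) Z)" for v
      using shadow_sgn_scale[OF cZ, of "1 + \<epsilon>" v] \<epsilon> by (simp add: n_def mult.assoc mult.left_commute)
    then show ?thesis by (simp only: \<Sigma>_def sum_list_const_mult)
  qed
  finally have 1: "n * vol Z \<le> (1 + \<epsilon>) ^ (n - 1) * \<Sigma>" .
  have term_ge: "2 * norm v * shadow (sgn v) Z + 2 * norm v * (m * t) \<le> 2 * norm v * shadow (sgn v) (?W + ?B)" for v
  proof (cases "v = 0")
    case False
    then have v: "norm (sgn v) = 1" by (simp add: norm_sgn)
    have "shadow (sgn v) (Z + ?B) \<le> shadow (sgn v) (?W + ?B)"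
      using vs(1) by (intro shadow_mono compact_convex_plus cZ cW cB set_plus_mono2 v) auto
    with sh[OF v] have "shadow (sgn v) Z + m * t \<le> shadow (sgn v) (?W + ?B)" by simp
    then have "2 * norm v * (shadow (sgn v) Z + m * t) \<le> 2 * norm v * shadow (sgn v) (?W + ?B)"
      by (intro mult_left_mono) auto
    then show ?thesis by (simp add: distrib_left)
  qed simp
  have "\<Sigma> + (m * t) * ?R \<le> \<Sigma> + (m * t) * (2 * M)"
    using M m t by (intro add_left_mono mult_left_mono) auto
  also have "\<dots> = (\<Sum>v\<leftarrow>vs. 2 * norm v * shadow (sgn v) Z + 2 * norm v * (m * t))"
    by (simp add: \<Sigma>_def M_def sum_list_addf sum_list_const_mult sum_list_mult_const mult_ac)
  also have "\<dots> \<le> (\<Sum>v\<leftarrow>vs. 2 * norm v * shadow (sgn v) (?W + ?B))"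
    by (intro sum_list_mono term_ge)
  finally have 2: "\<Sigma> + m * t * ?R \<le> (\<Sum>v\<leftarrow>vs. 2 * norm v * shadow (sgn v) (?W + ?B))" .
  have "?F + s * (\<Sigma> + m * t * ?R) \<le> vol (?W + ?B) + s * (\<Sum>v\<leftarrow>vs. 2 * norm v * shadow (sgn v) (?W + ?B))"
    using 2 s vs by (intro add_mono mult_left_mono vol_mono compact_convex_plus set_plus_mono2 cZ cW cB) auto
  also have "\<dots> = vol (?W + ?B) + (\<Sum>v\<leftarrow>map ((*\<^sub>R) s) vs. 2 * norm v * shadow (sgn v) (?W + ?B))"
    using s by (simp add: o_def sgn_scaleR_pos sum_list_const_mult[symmetric] mult.assoc mult.left_commute)
  also have "\<dots> \<le> vol (?W + ?B + zonotope (map ((*\<^sub>R) s) vs))"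
    by (intro vol_plus_zonotope_ge compact_convex_plus cW cB)
  also have "\<dots> = vol ((*\<^sub>R) (1 + s) ` ?W + ?B)"
    using s scale_add_convex[of ?W 1 s] by (simp add: zonotope_scale compact_convexD ac_simps)
  \<comment> \<open>Both summands lie in the dilate: the first by the choice of \<open>vs\<close>,
    the ball because it is convex and contains 0.\<close>
  also have "\<dots> \<le> vol ((*\<^sub>R) (1 + \<epsilon>) ` ((*\<^sub>R) (1 + s) ` Z + ?B))"
  proof (rule vol_mono)
    show "compact_convex ((*\<^sub>R) (1 + s) ` ?W + ?B)"
      by (intro compact_convex_plus cB) (intro compact_convex_scale cW)
    show "compact_convex ((*\<^sub>R) (1 + \<epsilon>) ` ((*\<^sub>R) (1 + s) ` Z + ?B))"
      by (rule compact_convex_scale[OF csZB])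
    have "(*\<^sub>R) (1 + s) ` ?W \<subseteq> (*\<^sub>R) (1 + \<epsilon>) ` (*\<^sub>R) (1 + s) ` Z"
      using image_mono[OF vs(2), of "(*\<^sub>R) (1 + s)"] by (simp only: scale_scale mult.commute)
    moreover have "?B \<subseteq> (*\<^sub>R) (1 + \<epsilon>) ` ?B"
      using \<epsilon> by (intro subset_scale compact_convexD[OF cB] zero_in_scale) auto
    ultimately show "(*\<^sub>R) (1 + s) ` ?W + ?B \<subseteq> (*\<^sub>R) (1 + \<epsilon>) ` ((*\<^sub>R) (1 + s) ` Z + ?B)"
      unfolding scale_plus by (rule set_plus_mono2)
  qed
  also have "\<dots> = (1 + \<epsilon>) ^ n * ?G"
    unfolding n_def using \<epsilon> by (intro vol_scale csZB) auto
  \<comment> \<open>The factor \<open>(1 + \<epsilon>) ^ (n - 1)\<close> puts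
    \<open>\<Sigma>\<close> into the form that is bounded below by \<open>n * vol Z\<close>.\<close>
  finally have "(1 + \<epsilon>) ^ (n - 1) * (?F + s * (\<Sigma> + m * t * ?R)) \<le> (1 + \<epsilon>) ^ (n - 1) * ((1 + \<epsilon>) ^ n * ?G)"
    using \<epsilon> by (intro mult_left_mono) auto
  moreover have "s * (n * vol Z) \<le> s * ((1 + \<epsilon>) ^ (n - 1) * \<Sigma>)" using 1 s by (intro mult_left_mono) auto
  ultimately show "(1 + \<epsilon>) ^ (n - 1) * (?F + s * (m * t * ?R)) + s * (n * vol Z) \<le> (1 + \<epsilon>) ^ (n - 1) * ((1 + \<epsilon>) ^ n * ?G)"
    by (simp add: algebra_simps)
qed

text \<open>Dilating \<open>Z\<close> by \<open>p = 1 + s\<close> is traded for shrinking the radius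
  of the ball to \<open>t / p\<close>, and superadditivity bounds the volume lost from
  \<open>t\<close> to \<open>t / p\<close> below by the surface area. First \<open>s\<close>, then
  \<open>t\<close> tends to 0.\<close>

lemma zonoid_surface_area_ge:
  fixes Z :: "'a::euclidean_space set"
  assumes Z: "zonoid Z" and ball: "zonoid (cball (0::'a) 1)" and m: "0 \<le> m"
    and sh: "\<And>\<xi> t. norm \<xi> = 1 \<Longrightarrow> 0 < t \<Longrightarrow> m * t \<le> shadow \<xi> (Z + (*\<^sub>R) t ` cball 0 1) - shadow \<xi> Z"
  defines "n \<equiv> DIM('a)"
  shows "m * root n (fact n * vol Z) \<le> (real n - 1) * surface_area Z"
proof -
  let ?B = "\<lambda>t. (*\<^sub>R) t ` cball (0::'a) 1"
  let ?F = "\<lambda>t. vol (Z + ?B t)" and ?R = "root n (fact n * vol Z)" and ?S = "surface_area Z"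
  have n: "0 < n" by (simp add: n_def)
  note cZ = zonoid_compact_convex[OF Z] and Z0 = zonoid_zero[OF Z]
  note S = surface_area_slope[OF cZ Z0 ball]
  have "n * ((?F t - vol Z) / t) - ?S \<ge> m * ?R" if t: "0 < t" for t
  proof -
    have "n * vol Z + m * t * ?R \<le> n * ?F t - ?S * t"
    proof (rule le_of_tendsto_at_right)
      show "((\<lambda>s. (1 + s) ^ (n - 1) * (n * ?F t - ?S * t)) \<longlongrightarrow> n * ?F t - ?S * t) (at_right 0)"
        by (auto intro!: tendsto_eq_intros)
      fix s :: real assume s: "0 < s"
      define p where "p = 1 + s"
      have p: "0 < p" using s by (simp add: p_def)
      have np: "p ^ n = p * p ^ (n - 1)" using n by (simp add: power_eq_if)
      have "?F t + s * (n * vol Z + m * t * ?R) \<le> vol ((*\<^sub>R) p ` Z + ?B t)"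
        unfolding p_def n_def by (rule vol_zonoid_plus_ball_ge[OF Z m t s sh[OF _ t]])
      also have "(*\<^sub>R) p ` Z + ?B t = (*\<^sub>R) p ` (Z + ?B (t / p))"
        unfolding scale_plus scale_scale using p by simp
      also have "vol \<dots> = p ^ n * ?F (t / p)"
        unfolding n_def using p by (intro vol_scale compact_convex_plus compact_convex_scale cZ) auto
      also have "\<dots> \<le> p ^ n * (?F t - ?S * (t * s / p))"
      proof (intro mult_left_mono)
        have "t / p + t * s / p = t * p / p"
          unfolding p_def by (simp add: add_divide_distrib[symmetric] distrib_left)
        then have "t / p + t * s / p = t" using p by simp
        then have "(?F (t / p) - vol Z) + (?F (t * s / p) - vol Z) \<le> ?F t - vol Z"
          using vol_zonoid_superadditive[OF cZ Z0 ball, of "t / p" "t * s / p"] p t s by simp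
        moreover have "?S * (t * s / p) \<le> ?F (t * s / p) - vol Z"
          using t s p by (intro S(2)) auto
        ultimately show "?F (t / p) \<le> ?F t - ?S * (t * s / p)" by simp
      qed (use p in auto)
      also have "\<dots> = p ^ n * ?F t - s * (p ^ (n - 1) * (?S * t))"
        unfolding np using p by (simp add: field_simps)
      finally have 1: "?F t + s * (n * vol Z + m * t * ?R) \<le> p ^ n * ?F t - s * (p ^ (n - 1) * (?S * t))" .
      \<comment> \<open>Applied to \<open>1 / p = 1 - s / p\<close>, Bernoulli's inequality bounds
        \<open>p ^ n - 1\<close> from above.\<close>
      have "1 + real n * (- s / p) \<le> (1 + (- s / p)) ^ n"
        using s p by (intro Bernoulli_inequality) (auto simp: p_def field_simps)
      also have "1 + (- s / p) = 1 / p" using p by (simp add: p_def field_simps)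
      finally have "p ^ n * (1 + real n * (- s / p)) \<le> p ^ n * (1 / p) ^ n" using p by (intro mult_left_mono) auto
      also have "\<dots> = 1" using p by (simp add: power_mult_distrib[symmetric])
      also have "p ^ n * (1 + real n * (- s / p)) = p ^ n - s * (n * p ^ (n - 1))"
        unfolding np using p by (simp add: field_simps)
      finally have "(p ^ n - s * (n * p ^ (n - 1))) * ?F t \<le> 1 * ?F t" by (intro mult_right_mono) auto
      with 1 have "s * (n * vol Z + m * t * ?R) \<le> s * (p ^ (n - 1) * (n * ?F t - ?S * t))"
        by (simp add: algebra_simps)
      then show "n * vol Z + m * t * ?R \<le> (1 + s) ^ (n - 1) * (n * ?F t - ?S * t)"
        using s by (simp add: p_def)
    qed
    moreover have "t * (n * (X / t) - ?S) = n * X - ?S * t" for X :: real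
      using t by (simp add: right_diff_distrib)
    then have "t * (n * ((?F t - vol Z) / t) - ?S) = n * (?F t - vol Z) - ?S * t" .
    ultimately have "t * (m * ?R) \<le> t * (n * ((?F t - vol Z) / t) - ?S)"
      by (simp add: algebra_simps)
    then show ?thesis using t by simp
  qed
  moreover have "((\<lambda>t. n * ((?F t - vol Z) / t) - ?S) \<longlongrightarrow> n * ?S - ?S) (at_right 0)"
    by (intro tendsto_intros S(1))
  ultimately have "m * ?R \<le> n * ?S - ?S" by (rule le_of_tendsto_at_right)
  then show ?thesis by (simp add: algebra_simps)
qed

subsection \<open>The constant\<close>

text \<open>The induction goes in steps of two, since the recursion of \<open>Gamma\<close> shifts
  \<open>n / 2\<close> by 1; the growth per step is controlled by
  \<open>(1 + 1 / x) ^ n \<le> exp 2\<close> for \<open>n = 2 * x\<close>.\<close>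

lemma Gamma_half_sq_le:
  assumes "1 \<le> n"
  shows "(real n / 2) ^ n * (Gamma (real n / 2 + 1))\<^sup>2 \<le> (fact n)\<^sup>2"
  using assms
proof (induction n rule: induct_nat_012)
  case 1
  have "Gamma (1 / 2 + 1 :: real) = 1 / 2 * Gamma (1 / 2)" by (rule Gamma_plus1) auto
  then have "Gamma (3 / 2 :: real) = sqrt pi / 2" by (simp add: Gamma_one_half_real)
  then have "(Gamma (3 / 2 :: real))\<^sup>2 = pi / 4" by (simp only: power_divide) simp
  then show ?case using pi_less_4 by simp
next
  case (ge2 n)
  show ?case
  \<comment> \<open>The claim starts at 1, so for 2 the induction hypothesis is void and the values
    are computed.\<close>
  proof (cases "n = 0")
    case True
    then show ?thesis by (simp add: numeral_2_eq_2[symmetric] Gamma_numeral fact_numeral)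
  next
    case False
    define x where "x = real n / 2"
    define a where "a = Gamma (x + 1)"
    have x: "0 < x" using False by (simp add: x_def)
    have G: "Gamma (x + 1 + 1) = (x + 1) * a"
      unfolding a_def using x by (intro Gamma_plus1) (auto dest!: nonpos_Ints_nonpos)
    have IH: "x ^ n * a\<^sup>2 \<le> (fact n)\<^sup>2" using ge2.IH(1) False by (simp add: x_def a_def)
    have key: "(x + 1)\<^sup>2 * (1 + 1 / x) ^ n \<le> 4 * (2 * x + 1)\<^sup>2"
    \<comment> \<open>The bound 9 for \<open>exp 2\<close> suffices once
      \<open>3 * (x + 1) \<le> 2 * (2 * x + 1)\<close>, that is \<open>x \<ge> 1\<close>; this
      leaves \<open>n = 1\<close> apart.\<close>
    proof (cases "n = 1")
      case True
      then show ?thesis by (simp add: x_def power2_eq_square)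
    next
      case False
      with \<open>n \<noteq> 0\<close> have x1: "1 \<le> x" by (simp add: x_def)
      have "(1 + 1 / x) ^ n \<le> exp (1 / x) ^ n" using x by (intro power_mono exp_ge_add_one_self) auto
      also have "\<dots> = exp (real n * (1 / x))" by (rule exp_of_nat_mult[symmetric])
      also have "real n * (1 / x) = 1 + 1" using x by (simp add: x_def)
      also have "exp (1 + 1 :: real) \<le> 3 * 3" unfolding exp_add by (intro mult_mono exp_le) auto
      finally have "(x + 1)\<^sup>2 * (1 + 1 / x) ^ n \<le> (x + 1)\<^sup>2 * 9" by (intro mult_left_mono) auto
      also have "\<dots> = (3 * (x + 1))\<^sup>2" by (simp add: power2_eq_square algebra_simps)
      also have "\<dots> \<le> (2 * (2 * x + 1))\<^sup>2" using x1 by (intro power_mono) auto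
      also have "\<dots> = 4 * (2 * x + 1)\<^sup>2" by (simp only: power_mult_distrib) simp
      finally show ?thesis .
    qed
    have "(x + 1) ^ (n + 2) * ((x + 1) * a)\<^sup>2 = (x + 1)\<^sup>2 * ((x + 1)\<^sup>2 * (1 + 1 / x) ^ n) * (x ^ n * a\<^sup>2)"
    proof -
      have "(1 + 1 / x) ^ n * x ^ n = (x + 1) ^ n"
        unfolding power_mult_distrib[symmetric] using x by (simp add: distrib_right)
      then show ?thesis by (simp add: power_add power2_eq_square mult_ac)
    qed
    also have "\<dots> \<le> (x + 1)\<^sup>2 * (4 * (2 * x + 1)\<^sup>2) * (fact n)\<^sup>2"
      using x by (intro mult_mono[OF mult_left_mono[OF key] IH]) auto
    also have "\<dots> = ((2 * x + 2) * ((2 * x + 1) * fact n))\<^sup>2" by (simp add: power2_eq_square algebra_simps)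
    also have "(2 * x + 2) * ((2 * x + 1) * fact n) = fact (n + 2)" by (simp add: x_def numeral_2_eq_2 algebra_simps)
    finally have "(x + 1) ^ (n + 2) * ((x + 1) * a)\<^sup>2 \<le> (fact (n + 2))\<^sup>2" .
    moreover have "real (Suc (Suc n)) / 2 = x + 1" by (simp add: x_def add_divide_distrib)
    ultimately show ?thesis by (simp only: G add_2_eq_Suc')
  qed
qed simp

text \<open>Log-convexity of \<open>Gamma\<close> at \<open>x + 1 / 2\<close>, the midpoint of
  \<open>x\<close> and \<open>x + 1\<close>.\<close>

lemma Gamma_half_quotient:
  assumes "0 < x"
  shows "x * (Gamma (x + 1 / 2))\<^sup>2 \<le> (Gamma (x + 1 :: real))\<^sup>2"
proof -
  have pos: "0 < Gamma x" "0 < Gamma (x + 1)" "0 < Gamma (x + 1 / 2)"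
    using assms by (auto intro!: Gamma_real_pos)
  have "(ln \<circ> Gamma) ((1 - 1 / 2) *\<^sub>R x + (1 / 2) *\<^sub>R (x + 1)) \<le> (1 - 1 / 2) * (ln \<circ> Gamma) x + (1 / 2) * (ln \<circ> Gamma) (x + 1)"
    using assms by (intro convex_onD[OF log_convex_Gamma_real]) auto
  moreover have "(1 - 1 / 2) *\<^sub>R x + (1 / 2) *\<^sub>R (x + 1) = x + 1 / 2" by (simp add: add_divide_distrib)
  ultimately have "2 * ln (Gamma (x + 1 / 2)) \<le> ln (Gamma x) + ln (Gamma (x + 1))" by simp
  then have "ln ((Gamma (x + 1 / 2))\<^sup>2) \<le> ln (Gamma x * Gamma (x + 1))"
    using pos by (simp add: ln_mult ln_realpow)
  then have "(Gamma (x + 1 / 2))\<^sup>2 \<le> Gamma x * Gamma (x + 1)" using pos by (subst (asm) ln_le_cancel_iff) auto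
  then have "x * (Gamma (x + 1 / 2))\<^sup>2 \<le> (x * Gamma x) * Gamma (x + 1)"
    using assms by (simp add: mult_left_mono mult.assoc)
  also have "x * Gamma x = Gamma (x + 1)"
    using assms by (intro Gamma_plus1[symmetric]) (auto dest!: nonpos_Ints_nonpos)
  finally show ?thesis by (simp add: power2_eq_square)
qed

text \<open>In the power \<open>n\<close> of the inequality, the powers of \<open>pi\<close> cancel
  because \<open>x * (n - 1) = n * (x - 1 / 2)\<close> for \<open>x = n / 2\<close>, and the factor
  2 absorbs the 2 in \<open>n = 2 * x\<close>. A pure \<open>Gamma\<close> inequality is
  left.\<close>

lemma b_const_ge:
  assumes n: "1 \<le> n"
  shows "(real n - 1) / root n (fact n) \<le> 2 * b_const n"
proof -
  define x where "x = real n / 2"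
  define a where "a = Gamma (x + 1)"
  define b where "b = Gamma (x + 1 / 2)"
  have x: "0 < x" "real n = 2 * x" using n by (auto simp: x_def)
  have pos: "0 < a" "0 < b" using x by (auto simp: a_def b_def intro!: Gamma_real_pos)
  let ?u = "unit_ball_vol (real n)" and ?w = "unit_ball_vol (real n - 1)"
  have u: "?u = pi powr x / a" by (simp add: unit_ball_vol_def x_def a_def)
  define q where "q = pi powr (x - 1 / 2)"
  have w: "?w = q / b"
    by (simp add: unit_ball_vol_def x_def b_def q_def diff_divide_distrib algebra_simps)
  have u0: "0 < ?u" and w0: "0 < ?w" using pos by (auto simp: u w q_def)
  then have u1: "?u \<noteq> 0" by linarith
  \<comment> \<open>Squared, this splits into \<open>n\<close> instances of
    \<open>x * b\<^sup>2 \<le> a\<^sup>2\<close> and one of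
    \<open>x ^ n * a\<^sup>2 \<le> (fact n)\<^sup>2\<close>.\<close>
  have ab: "x ^ n * b ^ n \<le> fact n * a ^ (n - 1)"
  proof (rule power2_le_imp_le)
    have "(x ^ n * b ^ n)\<^sup>2 = x ^ n * (x * b\<^sup>2) ^ n"
      by (simp add: power_mult_distrib power2_eq_square mult_ac)
    also have "\<dots> \<le> x ^ n * (a\<^sup>2) ^ n"
      using Gamma_half_quotient[OF x(1)] x by (intro mult_left_mono power_mono) (auto simp: a_def b_def)
    also have "\<dots> = (x ^ n * a\<^sup>2) * (a ^ (n - 1))\<^sup>2"
      using n by (cases n) (auto simp: power_mult_distrib power2_eq_square mult_ac)
    also have "\<dots> \<le> (fact n)\<^sup>2 * (a ^ (n - 1))\<^sup>2"
      using Gamma_half_sq_le[OF n] by (intro mult_right_mono) (auto simp: x_def a_def)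
    finally show "(x ^ n * b ^ n)\<^sup>2 \<le> (fact n * a ^ (n - 1))\<^sup>2" by (simp add: power_mult_distrib)
  qed (use pos in auto)
  have "(n * ?u powr ((real n - 1) / n)) ^ n \<le> (2 * ?w * root n (fact n)) ^ n"
  proof -
    have "(?u powr ((real n - 1) / n)) ^ n = (?u powr ((real n - 1) / n)) powr real n"
      using u1 by (subst powr_realpow) auto
    also have "\<dots> = ?u powr (real (n - 1))"
      using n by (simp add: powr_powr of_nat_diff)
    also have "\<dots> = ?u ^ (n - 1)" using u0 by (simp add: powr_realpow)
    finally have L: "(n * ?u powr ((real n - 1) / n)) ^ n = (2 * x) ^ n * ?u ^ (n - 1)"
      by (simp add: power_mult_distrib x)
    have R: "(2 * ?w * root n (fact n)) ^ n = 2 ^ n * ?w ^ n * fact n"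
      using n by (simp add: power_mult_distrib)
    have pp: "(pi powr x) ^ (n - 1) = q ^ n"
      using n by (simp add: q_def powr_realpow[symmetric] powr_powr of_nat_diff x algebra_simps)
    have "(2 * x) ^ n * ?u ^ (n - 1) = 2 ^ n * (pi powr x) ^ (n - 1) * (x ^ n * b ^ n) / (a ^ (n - 1) * b ^ n)"
      using pos by (simp add: u power_divide power_mult_distrib field_simps)
    also have "\<dots> \<le> 2 ^ n * (pi powr x) ^ (n - 1) * (fact n * a ^ (n - 1)) / (a ^ (n - 1) * b ^ n)"
      using ab pos by (intro divide_right_mono mult_left_mono) auto
    also have "\<dots> = 2 ^ n * ?w ^ n * fact n"
      using pos unfolding pp w power_divide by (simp add: field_simps)
    finally show ?thesis unfolding L R .
  qed
  then have "n * ?u powr ((real n - 1) / n) \<le> 2 * ?w * root n (fact n)"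
    using w0 n by (subst (asm) power_mono_iff) auto
  moreover have "0 < root n (fact n)" using n by simp
  moreover have "0 < n * ?u powr ((real n - 1) / n)" using u1 n by simp
  ultimately have "1 / root n (fact n) \<le> 2 * ?w / (n * ?u powr ((real n - 1) / n))"
    by (simp add: field_simps)
  then have "(real n - 1) * (1 / root n (fact n)) \<le> (real n - 1) * (2 * ?w / (n * ?u powr ((real n - 1) / n)))"
    using n by (intro mult_left_mono) auto
  then show ?thesis by (simp add: b_const_def mult_ac)
qed

subsection \<open>The inequality\<close>

theorem theorem1p3:
  fixes Z :: "(real ^ 'n) set"
  assumes "CARD('n) \<ge> 2"
    and "projection_body Z"
  shows "measure lborel Z powr (1 / real CARD('n))
           * (INF \<xi>\<in>sphere 0 1. surface_area_in (perp \<xi>) (perp_proj \<xi> ` Z))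
         \<le> 2 * b_const CARD('n) * surface_area Z"
proof -
  let ?n = "CARD('n)" and ?s = "\<lambda>\<xi>. surface_area_in (perp \<xi>) (perp_proj \<xi> ` Z)"
  define m where "m = (INF \<xi>\<in>sphere 0 1. ?s \<xi>)"
  have n: "1 \<le> ?n" using assms(1) by simp
  have Z: "zonoid Z" by (rule projection_body_zonoid[OF assms(2)])
  note sh = surface_area_in_shadow[OF zonoid_compact_convex[OF Z] zonoid_zero[OF Z] zonoid_cball]
  have bdd: "bdd_below (?s ` sphere 0 1)"
    by (intro bdd_belowI2[of _ 0] sh(1)) simp
  have m0: "0 \<le> m" unfolding m_def by (intro cINF_greatest sh(1)) (auto simp: sphere_eq_empty)
  have "m * root ?n (fact ?n * vol Z) \<le> (real ?n - 1) * surface_area Z"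
  proof -
    have "m * t \<le> shadow \<xi> (Z + (*\<^sub>R) t ` cball 0 1) - shadow \<xi> Z" if "norm \<xi> = 1" "0 < t" for \<xi> t
    proof -
      have "m \<le> ?s \<xi>" unfolding m_def using that by (intro cINF_lower[OF bdd]) simp
      then have "m * t \<le> ?s \<xi> * t" using that by (intro mult_right_mono) auto
      with sh(2)[OF that] show ?thesis by simp
    qed
    from zonoid_surface_area_ge[OF Z zonoid_cball m0 this] show ?thesis by simp
  qed
  then have le: "root ?n (fact ?n) * (root ?n (vol Z) * m) \<le> (real ?n - 1) * surface_area Z"
    by (simp add: real_root_mult mult_ac)
  have r: "0 < root ?n (fact ?n)" by simp
  \<comment> \<open>The sign of the surface area is read off the inequality just proved, as
    \<open>n \<ge> 2\<close> makes \<open>n - 1\<close> positive.\<close>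
  have "0 \<le> root ?n (fact ?n) * (root ?n (vol Z) * m)" using m0 r by (intro mult_nonneg_nonneg) auto
  with le have "0 \<le> (real ?n - 1) * surface_area Z" by linarith
  then have S0: "0 \<le> surface_area Z" using assms(1) by (auto simp: zero_le_mult_iff)
  have "root ?n (vol Z) * m \<le> (real ?n - 1) / root ?n (fact ?n) * surface_area Z"
    using le r by (simp add: field_simps)
  also have "\<dots> \<le> 2 * b_const ?n * surface_area Z"
    by (intro mult_right_mono b_const_ge n S0)
  also have "root ?n (vol Z) = vol Z powr (1 / ?n)"
    using n by (simp add: root_powr_inverse)
  finally show ?thesis by (simp add: m_def)
qed

end
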